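(* There are universal constants $c_1,c_2>0$ such that for any $M,K,R\ge1$ and $H,\Delta,\sigma>0$, there exists a function $F\in\mathcal{F}_{-H}(H,\Delta)$ in a sufficiently large dimension $D\ge c_1\cdot KR\log(MKR)$ (with a stochastic gradient oracle $\mathcal{O}_g^\sigma$ for $F$) such that for any algorithm in $\mathcal{A}^\infty(\mathcal{G}_{\mathrm{I.C.}},\mathcal{O}_g^\sigma)$, its output $\hat x$ satisfies $$\mathbb{E}\|\nabla F(\hat x)\|\ge c_2\min\left\{\frac{\sqrt{H\Delta}}{\sqrt{KR}}+\frac{\sqrt\sigma(H\Delta)^{1/4}}{(KR)^{1/4}},\ \frac{\sqrt{H\Delta}}{\sqrt{R(1+\log M)}}+\frac{\sqrt\sigma(H\Delta)^{1/4}}{(MKR)^{1/4}},\ \sqrt{H\Delta}\right\}.$$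
   Context: $\mathcal{F}_{-H}(H,\Delta)$: all $H$-smooth (gradient $H$-Lipschitz), possibly non-convex functions $F:\mathbb{R}^d\to\mathbb{R}$ with $F(0)-\min_xF(x)\le\Delta$. Oracle $\mathcal{O}_g^\sigma$ for $F$: when queried at $x$ it returns a random vector with mean $\nabla F(x)$ and $\mathbb{E}\|\mathcal{O}_g^\sigma(x)-\nabla F(x)\|^2\le\sigma^2$, which, given $x$, is independent of the algorithm's state and of all other oracle interactions. Intermittent communication setting: $M$ machines, $R$ rounds, $K$ oracle queries per machine per round. A (possibly randomized) algorithm has a random seed $\xi$ independent of the oracle and is given by measurable rules: the $k$-th query $x^m_{k,r}\in\mathbb{R}^D$ of machine $m$ in round $r$ is a function of $\xi$ and of all (query, oracle answer) pairs at indices $(m,k',r)$ with $k'<k$ and $(m',k',r')$ with $r'<r$ ($m'\in[M],k'\in[K]$ arbitrary); the output $\hat x$ is a function of $\xi$ and all $MKR$ (query, answer) pairs. $\mathcal{A}^\infty(\mathcal{G}_{\mathrm{I.C.}},\mathcal{O}_g^\sigma)$ is the class of all such algorithms, with no bound on the norm of queries.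
   Formalization: F and its oracle are chosen after the algorithm: for one fixed F the claim is false, since the algorithm that always outputs a minimizer of F has zero gradient. The bound is proved for every D ≥ max(1, c₁KR log(MKR)); the random seed is real-valued, which covers all seeds. *)

theory Defs
  imports "HOL-Probability.Probability"
begin

text \<open>
  The constants of the theorem must not depend on the dimension, so the dimension cannot be a
  type parameter. Vectors are extensional functions on \<open>{..<D}\<close>, i.e. the elements of
  \<open>space (RD D)\<close>.
\<close>

type_synonym rvec = "nat \<Rightarrow> real"

abbreviation RD :: "nat \<Rightarrow> rvec measure" where
  "RD D \<equiv> Pi\<^sub>M {..<D} (\<lambda>_. borel)"

abbreviation norm_RD :: "nat \<Rightarrow> rvec \<Rightarrow> real" where
  "norm_RD D x \<equiv> L2_set x {..<D}"

abbreviation dist_RD :: "nat \<Rightarrow> rvec \<Rightarrow> rvec \<Rightarrow> real" where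
  "dist_RD D x y \<equiv> L2_set (\<lambda>i. x i - y i) {..<D}"

text \<open>Frechet differentiability, in the form of \<open>has_derivative_at_alt\<close>.\<close>

definition has_gradient :: "nat \<Rightarrow> (rvec \<Rightarrow> real) \<Rightarrow> rvec \<Rightarrow> rvec \<Rightarrow> bool" where
  "has_gradient D F x g \<longleftrightarrow> g \<in> space (RD D) \<and>
     (\<forall>e>0. \<exists>d>0. \<forall>y\<in>space (RD D). dist_RD D y x < d \<longrightarrow>
        \<bar>F y - F x - (\<Sum>i<D. g i * (y i - x i))\<bar> \<le> e * dist_RD D y x)"

definition grad :: "nat \<Rightarrow> (rvec \<Rightarrow> real) \<Rightarrow> rvec \<Rightarrow> rvec" where
  "grad D F x = (THE g. has_gradient D F x g)"

lemma has_gradient_unique: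
  assumes x: "x \<in> space (RD D)" and g: "has_gradient D F x g" and h: "has_gradient D F x h"
  shows "g = h"
proof (rule ccontr)
  assume "g \<noteq> h"
  have gh: "g \<in> space (RD D)" "h \<in> space (RD D)"
    using g h by (auto simp: has_gradient_def)
  then obtain j where j: "j < D" "g j \<noteq> h j"
    using \<open>g \<noteq> h\<close> by (metis PiE_ext lessThan_iff space_PiM)
  define e where "e = \<bar>g j - h j\<bar> / 4"
  have e: "e > 0" using j by (simp add: e_def)
  obtain d1 where d1: "d1 > 0" "\<And>y. y \<in> space (RD D) \<Longrightarrow> dist_RD D y x < d1 \<Longrightarrow>
      \<bar>F y - F x - (\<Sum>i<D. g i * (y i - x i))\<bar> \<le> e * dist_RD D y x"
    using g e unfolding has_gradient_def by meson
  obtain d2 where d2: "d2 > 0" "\<And>y. y \<in> space (RD D) \<Longrightarrow> dist_RD D y x < d2 \<Longrightarrow>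
      \<bar>F y - F x - (\<Sum>i<D. h i * (y i - x i))\<bar> \<le> e * dist_RD D y x"
    using h e unfolding has_gradient_def by meson
  define t where "t = min d1 d2 / 2"
  have t: "t > 0" "t < d1" "t < d2" using d1(1) d2(1) by (auto simp: t_def)
  define y where "y = x(j := x j + t)"
  have y: "y \<in> space (RD D)"
    using x j by (auto simp: y_def space_PiM PiE_def extensional_def)
  have diff: "y i - x i = (if i = j then t else 0)" for i
    by (simp add: y_def)
  have dist: "dist_RD D y x = t"
    using j t by (simp add: diff L2_set_def if_distrib[of "\<lambda>u. u\<^sup>2"] cong: if_cong)
  have sums: "(\<Sum>i<D. u i * (y i - x i)) = u j * t" for u :: rvec
    using j by (simp add: diff if_distrib[of "\<lambda>v. _ * v"] cong: if_cong)
  have "\<bar>F y - F x - g j * t\<bar> \<le> e * t" "\<bar>F y - F x - h j * t\<bar> \<le> e * t"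
    using d1(2)[OF y] d2(2)[OF y] t unfolding dist sums by auto
  then have "\<bar>g j * t - h j * t\<bar> \<le> 2 * e * t" by linarith
  also have "\<bar>g j * t - h j * t\<bar> = 4 * e * t"
    using t by (simp add: e_def abs_mult flip: left_diff_distrib)
  finally show False using e t by simp
qed

lemma grad_eqI: "x \<in> space (RD D) \<Longrightarrow> has_gradient D F x g \<Longrightarrow> grad D F x = g"
  unfolding grad_def by (blast intro: has_gradient_unique)

definition smooth_RD :: "nat \<Rightarrow> real \<Rightarrow> (rvec \<Rightarrow> real) \<Rightarrow> bool" where
  "smooth_RD D H F \<longleftrightarrow>
     (\<forall>x\<in>space (RD D). \<exists>g. has_gradient D F x g) \<and>
     (\<forall>x\<in>space (RD D). \<forall>y\<in>space (RD D).
        dist_RD D (grad D F x) (grad D F y) \<le> H * dist_RD D x y)"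

definition nonconvex_class :: "nat \<Rightarrow> real \<Rightarrow> real \<Rightarrow> (rvec \<Rightarrow> real) set" where
  "nonconvex_class D H \<Delta> =
     {F. smooth_RD D H F \<and>
         (\<exists>xmin\<in>space (RD D). (\<forall>x\<in>space (RD D). F xmin \<le> F x) \<and>
            F (\<lambda>i\<in>{..<D}. 0) - F xmin \<le> \<Delta>)}"

text \<open>
  An oracle is a measurable map \<open>G\<close> from a query and a noise variable with law \<open>Z\<close> to an answer;
  every call uses its own independent noise variable.
  Real noise is no restriction: every probability kernel into \<open>RD D\<close> has this form.
\<close>

definition stoch_grad_oracle ::
  "nat \<Rightarrow> (rvec \<Rightarrow> real) \<Rightarrow> real \<Rightarrow> real measure \<Rightarrow> (rvec \<times> real \<Rightarrow> rvec) \<Rightarrow> bool" where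
  "stoch_grad_oracle D F \<sigma> Z G \<longleftrightarrow>
     prob_space Z \<and> G \<in> RD D \<Otimes>\<^sub>M Z \<rightarrow>\<^sub>M RD D \<and>
     (\<forall>x\<in>space (RD D).
        (\<forall>i<D. integrable Z (\<lambda>z. G (x, z) i) \<and> (\<integral>z. G (x, z) i \<partial>Z) = grad D F x i) \<and>
        (\<integral>\<^sup>+z. ennreal ((dist_RD D (G (x, z)) (grad D F x))\<^sup>2) \<partial>Z) \<le> ennreal (\<sigma>\<^sup>2))"

text \<open>
  An index \<open>(m, k, r)\<close> is query \<open>k\<close> of machine \<open>m\<close> in round \<open>r\<close>, all counted from \<open>0\<close>.
\<close>

type_synonym idx = "nat \<times> nat \<times> nat"
type_synonym history = "idx \<Rightarrow> rvec \<times> rvec"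

definition ic_indices :: "nat \<Rightarrow> nat \<Rightarrow> nat \<Rightarrow> idx set" where
  "ic_indices M K R = {..<M} \<times> {..<K} \<times> {..<R}"

definition ic_visible :: "nat \<Rightarrow> nat \<Rightarrow> idx \<Rightarrow> idx set" where
  "ic_visible M K = (\<lambda>(m, k, r). {m} \<times> {..<k} \<times> {r} \<union> {..<M} \<times> {..<K} \<times> {..<r})"

abbreviation history_space :: "nat \<Rightarrow> idx set \<Rightarrow> history measure" where
  "history_space D I \<equiv> Pi\<^sub>M I (\<lambda>_. RD D \<Otimes>\<^sub>M RD D)"

text \<open>
  The seed has law \<open>S\<close>, which may live on any sigma-algebra on the reals. The seed type is fixed
  because a type variable would allow the constants of the theorem to depend on it.
\<close>

definition ic_algorithm ::
  "nat \<Rightarrow> nat \<Rightarrow> nat \<Rightarrow> nat \<Rightarrow> real measure \<Rightarrow> (idx \<Rightarrow> real \<times> history \<Rightarrow> rvec) \<Rightarrow>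
     (real \<times> history \<Rightarrow> rvec) \<Rightarrow> bool" where
  "ic_algorithm M K R D S query out \<longleftrightarrow>
     prob_space S \<and>
     (\<forall>j\<in>ic_indices M K R.
        query j \<in> S \<Otimes>\<^sub>M history_space D (ic_visible M K j) \<rightarrow>\<^sub>M RD D) \<and>
     out \<in> S \<Otimes>\<^sub>M history_space D (ic_indices M K R) \<rightarrow>\<^sub>M RD D"

lemma restrict_fundef_cong [fundef_cong]:
  "A = B \<Longrightarrow> (\<And>x. x \<in> B \<Longrightarrow> f x = g x) \<Longrightarrow> restrict f A = restrict g B"
  by (auto simp: restrict_def)

text \<open>The (query, answer) pairs produced by seed \<open>w\<close> and noise variables \<open>z\<close>.\<close>

function ic_transcript ::
  "nat \<Rightarrow> nat \<Rightarrow> (idx \<Rightarrow> real \<times> history \<Rightarrow> rvec) \<Rightarrow> (rvec \<times> real \<Rightarrow> rvec) \<Rightarrow>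
     real \<Rightarrow> (idx \<Rightarrow> real) \<Rightarrow> history" where
  "ic_transcript M K query G w z j =
     (let x = query j (w, \<lambda>j'\<in>ic_visible M K j. ic_transcript M K query G w z j')
      in (x, G (x, z j)))"
  by auto
termination
  by (relation "inv_image (less_than <*lex*> less_than) (\<lambda>(M, K, query, G, w, z, m, k, r). (r, k))")
     (auto simp: ic_visible_def)

declare ic_transcript.simps [simp del]

definition ic_output ::
  "nat \<Rightarrow> nat \<Rightarrow> nat \<Rightarrow> (idx \<Rightarrow> real \<times> history \<Rightarrow> rvec) \<Rightarrow> (real \<times> history \<Rightarrow> rvec) \<Rightarrow>
     (rvec \<times> real \<Rightarrow> rvec) \<Rightarrow> real \<Rightarrow> (idx \<Rightarrow> real) \<Rightarrow> rvec" where
  "ic_output M K R query out G w z =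
     out (w, \<lambda>j\<in>ic_indices M K R. ic_transcript M K query G w z j)"

text \<open>
  The expectation is a nonnegative integral because it may be infinite.
\<close>

definition expected_grad_norm ::
  "nat \<Rightarrow> nat \<Rightarrow> nat \<Rightarrow> nat \<Rightarrow> real measure \<Rightarrow> (idx \<Rightarrow> real \<times> history \<Rightarrow> rvec) \<Rightarrow>
     (real \<times> history \<Rightarrow> rvec) \<Rightarrow> (rvec \<Rightarrow> real) \<Rightarrow> real measure \<Rightarrow>
     (rvec \<times> real \<Rightarrow> rvec) \<Rightarrow> ennreal" where
  "expected_grad_norm M K R D S query out F Z G =
     (\<integral>\<^sup>+(w, z). ennreal (norm_RD D (grad D F (ic_output M K R query out G w z)))
        \<partial>(S \<Otimes>\<^sub>M Pi\<^sub>M (ic_indices M K R) (\<lambda>_. Z)))"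

end

theory Submission
  imports Defs
begin

text \<open>
  The hard function is a chain of \<open>T\<close> blocks of coordinates, each block carrying hidden random signs
  \<open>e\<close>. The chain variable of a block is the average of \<open>e k * arctan (b * x k)\<close>; a block contributes
  to the gradient only once the variable of the block before it exceeds \<open>1/4\<close>, and as long as the last
  variable is below \<open>1/2\<close> the gradient is large. A query that is independent of the signs of a block
  has a small variable there, by Hoeffding's inequality and because \<open>arctan\<close> is bounded, so a run
  learns the blocks one after the other. The oracle moreover reveals the next block only with
  probability \<open>p\<close>. Hence the number of known blocks is bounded by a function of the noise alone: the
  sum over the rounds of the largest number of successes of a machine. If this is below \<open>T\<close> with
  probability \<open>3/4\<close>, then averaging over the signs yields signs for which the algorithm fails.
  Smoothness and the bound on the initial gap give gradients of size \<open>sqrt (H * \<Delta> / T)\<close>, and the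
  variance is admissible if \<open>H * \<Delta> / T \<le> p * \<sigma>\<^sup>2\<close>. When \<open>M = K = R = 1\<close> the dimension may be \<open>1\<close>,
  and translated Huber functions replace the chain.
\<close>

subsection \<open>Smoothness from a quadratic remainder\<close>

text \<open>Queries have unbounded norm, which is why bounded terms are averaged over a block:
  correlation with unknown signs is then small for every query. The price is that arctan flattens
  far out; the quadratic term restores a gradient there. The obstacle is that queries depend on
  answers and answers on the signs. Each run is therefore compared with runs against truncated
  signs, the unknown ones set to 0. There independence holds by construction, and an induction shows
  that both agree outside a rare event. Scaling: amplitude about Delta / T and smoothness H give
  gradients of size sqrt (H Delta / T) for every block size n, so n of order log (MKR) suffices for
  the union bound over queries and blocks. With h^2 = H Delta, the variance asks for h^2 / T <= p
  sigma^2, while T must exceed about p N successes, where N is KR or MKR. Balancing gives p = h /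
  (sigma sqrt N) and h^2 / T of order sigma h / sqrt N, the origin of the fourth roots. The term R
  log M is the price of a union bound over the M^R choices of one machine per round.\<close>

lemma norm_RD_sq: "(norm_RD D x)\<^sup>2 = (\<Sum>i<D. (x i)\<^sup>2)"
  by (simp add: L2_set_def sum_nonneg)

lemma quadratic_remainder_imp_has_gradient:
  assumes C: "C \<ge> 0" and x: "x \<in> space (RD D)" and g: "g \<in> space (RD D)"
    and rem: "\<And>y. y \<in> space (RD D) \<Longrightarrow>
      \<bar>F y - F x - (\<Sum>i<D. g i * (y i - x i))\<bar> \<le> C * (dist_RD D y x)\<^sup>2"
  shows "has_gradient D F x g"
  unfolding has_gradient_def
proof (intro conjI allI impI g)
  fix e :: real assume e: "e > 0"
  show "\<exists>d>0. \<forall>y\<in>space (RD D). dist_RD D y x < d \<longrightarrow>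
        \<bar>F y - F x - (\<Sum>i<D. g i * (y i - x i))\<bar> \<le> e * dist_RD D y x"
  \<comment> \<open>The \<open>+ 1\<close> covers \<open>C = 0\<close>.\<close>
  proof (intro exI[of _ "e / (C + 1)"] conjI ballI impI)
    show "0 < e / (C + 1)" using e C by simp
    fix y assume y: "y \<in> space (RD D)" and d: "dist_RD D y x < e / (C + 1)"
    have "C * dist_RD D y x \<le> (C + 1) * dist_RD D y x"
      by (intro mult_right_mono) (auto simp: L2_set_nonneg)
    also have "\<dots> \<le> e"
      using d C by (simp add: field_simps)
    finally have "C * (dist_RD D y x)\<^sup>2 \<le> e * dist_RD D y x"
      by (simp add: power2_eq_square mult_right_mono L2_set_nonneg mult.assoc[symmetric])
    with rem[OF y] show "\<bar>F y - F x - (\<Sum>i<D. g i * (y i - x i))\<bar> \<le> e * dist_RD D y x"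
      by linarith
  qed
qed

text \<open>
  Comparing the expansions at \<open>x\<close> and \<open>y\<close> in a third point \<open>z\<close>, placed at distance
  \<open>dist x y\<close> from \<open>y\<close> in the direction \<open>g y - g x\<close>.
\<close>

lemma quadratic_remainder_imp_smooth:
  assumes C: "C \<ge> 0" and g: "\<And>x. x \<in> space (RD D) \<Longrightarrow> g x \<in> space (RD D)"
    and rem: "\<And>x y. x \<in> space (RD D) \<Longrightarrow> y \<in> space (RD D) \<Longrightarrow>
      \<bar>F y - F x - (\<Sum>i<D. g x i * (y i - x i))\<bar> \<le> C * (dist_RD D y x)\<^sup>2"
  shows "smooth_RD D (6 * C) F" and "\<And>x. x \<in> space (RD D) \<Longrightarrow> grad D F x = g x"
proof -
  have hg: "has_gradient D F x (g x)" if "x \<in> space (RD D)" for x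
    using quadratic_remainder_imp_has_gradient[OF C that g[OF that]] rem that by blast
  show gr: "grad D F x = g x" if "x \<in> space (RD D)" for x
    using grad_eqI[OF that hg[OF that]] .
  show "smooth_RD D (6 * C) F"
    unfolding smooth_RD_def
  proof (intro conjI ballI)
    show "\<exists>g. has_gradient D F x g" if "x \<in> space (RD D)" for x using hg[OF that] by blast
    fix x y assume x: "x \<in> space (RD D)" and y: "y \<in> space (RD D)"
    define a where "a = dist_RD D (g x) (g y)"
    define b where "b = dist_RD D x y"
    have b0: "b \<ge> 0" and a0: "a \<ge> 0" by (auto simp: a_def b_def L2_set_nonneg)
    have sa: "(\<Sum>i<D. (g y i - g x i)\<^sup>2) = a\<^sup>2"
      unfolding a_def norm_RD_sq by (simp add: power2_commute)
    have sb: "(\<Sum>i<D. (y i - x i)\<^sup>2) = b\<^sup>2"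
      unfolding b_def norm_RD_sq by (simp add: power2_commute)
    have "a \<le> 6 * C * b"
    proof (cases "a = 0")
      case True then show ?thesis using C b0 by simp
    next
      case False
      then have ap: "a > 0" using a0 by simp
      define z where "z = (\<lambda>i\<in>{..<D}. y i + b / a * (g y i - g x i))"
      have z: "z \<in> space (RD D)" by (auto simp: z_def space_PiM)
      have zy: "(dist_RD D z y)\<^sup>2 = b\<^sup>2"
      proof -
        have "(dist_RD D z y)\<^sup>2 = (\<Sum>i<D. (b/a)\<^sup>2 * (g y i - g x i)\<^sup>2)"
          unfolding norm_RD_sq by (intro sum.cong) (auto simp: z_def power_mult_distrib power_divide)
        also have "\<dots> = (b/a)\<^sup>2 * a\<^sup>2" by (simp add: sum_distrib_left[symmetric] sa)
        finally show ?thesis using ap by (simp add: power_divide)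
      qed
      have zx: "(dist_RD D z x)\<^sup>2 \<le> 4 * b\<^sup>2"
      proof -
        have "(dist_RD D z x)\<^sup>2 \<le> (\<Sum>i<D. 2 * (z i - y i)\<^sup>2 + 2 * (y i - x i)\<^sup>2)"
          unfolding norm_RD_sq
        proof (intro sum_mono)
          fix i
          have "0 \<le> ((z i - y i) - (y i - x i))\<^sup>2" by simp
          then show "(z i - x i)\<^sup>2 \<le> 2 * (z i - y i)\<^sup>2 + 2 * (y i - x i)\<^sup>2"
            by (simp add: power2_eq_square algebra_simps)
        qed
        also have "\<dots> = 2 * (dist_RD D z y)\<^sup>2 + 2 * b\<^sup>2"
          unfolding norm_RD_sq sb[symmetric] by (simp add: sum.distrib sum_distrib_left)
        finally show ?thesis using zy by simp
      qed
      have yx: "(dist_RD D y x)\<^sup>2 = b\<^sup>2" using sb unfolding norm_RD_sq .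
      \<comment> \<open>The three remainders contribute 4 + 1 + 1 = 6 times
        \<open>C * b\<^sup>2\<close>; by the choice of \<open>z\<close> the linear parts combine to
        \<open>b * a\<close>.\<close>
      have r1: "\<bar>F z - F x - (\<Sum>i<D. g x i * (z i - x i))\<bar> \<le> C * (4 * b\<^sup>2)"
        using rem[OF x z] mult_left_mono[OF zx C] by linarith
      have r2: "\<bar>F z - F y - (\<Sum>i<D. g y i * (z i - y i))\<bar> \<le> C * b\<^sup>2"
        using rem[OF y z] zy by simp
      have r3: "\<bar>F y - F x - (\<Sum>i<D. g x i * (y i - x i))\<bar> \<le> C * b\<^sup>2"
        using rem[OF x y] yx by simp
      have "(\<Sum>i<D. g y i * (z i - y i)) - ((\<Sum>i<D. g x i * (z i - x i)) - (\<Sum>i<D. g x i * (y i - x i)))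
          = (\<Sum>i<D. b / a * (g y i - g x i)\<^sup>2)"
        unfolding sum_subtractf[symmetric]
        by (intro sum.cong) (auto simp: z_def power2_eq_square algebra_simps)
      also have "\<dots> = b * a"
        unfolding sum_distrib_left[symmetric] sa using ap by (simp add: power2_eq_square)
      finally have "b * a \<le> 6 * C * b\<^sup>2" using r1 r2 r3 by (simp add: algebra_simps)
      \<comment> \<open>A factor \<open>b\<close> is to be cancelled, so \<open>b = 0\<close> is
        separate: then \<open>x = y\<close> by extensionality.\<close>
      moreover have "a = 0" if "b = 0"
      proof -
        have "x = y"
          using that x y unfolding b_def L2_set_eq_0_iff[OF finite_lessThan]
          by (intro PiE_ext[where k="{..<D}" and s="\<lambda>_. UNIV"]) (auto simp: space_PiM)
        then show ?thesis by (simp add: a_def L2_set_eq_0_iff)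
      qed
      ultimately show ?thesis
        using b0 by (cases "b = 0") (auto simp: power2_eq_square)
    qed
    then show "dist_RD D (grad D F x) (grad D F y) \<le> 6 * C * dist_RD D x y"
      using gr x y by (simp add: a_def b_def)
  qed
qed

section \<open>Scalar profiles: a spline step and the arctangent\<close>

definition psi :: "real \<Rightarrow> real" where
  "psi t = 32 * ((max 0 (t - 1/4))\<^sup>2 - 2 * (max 0 (t - 3/8))\<^sup>2 + (max 0 (t - 1/2))\<^sup>2)"

definition psi' :: "real \<Rightarrow> real" where
  "psi' t = 64 * (max 0 (t - 1/4) - 2 * max 0 (t - 3/8) + max 0 (t - 1/2))"

lemma psi_low: "t \<le> 1/4 \<Longrightarrow> psi t = 0" "t \<le> 1/4 \<Longrightarrow> psi' t = 0"
  by (auto simp: psi_def psi'_def)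

lemma psi_high: "t \<ge> 1/2 \<Longrightarrow> psi t = 1"
  by (simp add: psi_def power2_eq_square algebra_simps)

lemma psi'_bounds: "0 \<le> psi' t" "psi' t \<le> 8"
  by (auto simp: psi'_def max_def)

lemma psi_bounds: "0 \<le> psi t" "psi t \<le> 1"
proof -
  consider "t \<le> 1/4" | "1/4 \<le> t" "t \<le> 3/8" | "3/8 \<le> t" "t \<le> 1/2" | "t \<ge> 1/2" by linarith
  then have "0 \<le> psi t \<and> psi t \<le> 1"
  proof cases
    case 2
    then have "(t - 1/4)\<^sup>2 \<le> (1/8)\<^sup>2" by (intro power_mono) auto
    then show ?thesis using 2 by (simp add: psi_def power2_eq_square)
  next
    case 3
    have e: "psi t = 1 - 32 * (1/2 - t)\<^sup>2"
      using 3 by (simp add: psi_def power2_eq_square algebra_simps)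
    have "(1/2 - t)\<^sup>2 \<le> (1/8)\<^sup>2" using 3 by (intro power_mono) auto
    then show ?thesis unfolding e by (simp add: power2_eq_square)
  qed (auto simp: psi_low psi_high)
  then show "0 \<le> psi t" "psi t \<le> 1" by auto
qed

text \<open>The square of the positive part is convex with 2-Lipschitz derivative. Both
  \<open>psi\<close> and the Huber function below are assembled from shifted copies of it.\<close>

lemma max_sq_remainder:
  fixes a b :: real
  shows "0 \<le> (max 0 b)\<^sup>2 - (max 0 a)\<^sup>2 - 2 * max 0 a * (b - a)"
    and "(max 0 b)\<^sup>2 - (max 0 a)\<^sup>2 - 2 * max 0 a * (b - a) \<le> (b - a)\<^sup>2"
proof -
  have 1: "a * (b * 2) \<le> a * a" if "a \<ge> 0" "b \<le> 0"
    using that mult_left_mono[of "b * 2" a a] by simp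
  have 2: "a * b \<le> 0" if "a \<le> 0" "b \<ge> 0" using that by (simp add: mult_nonpos_nonneg)
  have 3: "0 \<le> (b - a)\<^sup>2" by simp
  show "0 \<le> (max 0 b)\<^sup>2 - (max 0 a)\<^sup>2 - 2 * max 0 a * (b - a)"
    using 1 3 by (cases "a \<ge> 0"; cases "b \<ge> 0") (auto simp: power2_eq_square algebra_simps max_def)
  show "(max 0 b)\<^sup>2 - (max 0 a)\<^sup>2 - 2 * max 0 a * (b - a) \<le> (b - a)\<^sup>2"
    using 2 3 zero_le_power2[of b] by (cases "a \<ge> 0"; cases "b \<ge> 0") (auto simp: power2_eq_square algebra_simps max_def)
qed

text \<open>\<open>psi\<close> is the quadratic spline step from 0 at 1/4 to 1 at 1/2 with
  inflection at 3/8. Its remainder is a combination of three remainders in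
  \<open>[0, (b - a)\<^sup>2]\<close> with weights 32, -64, 32, hence the constant 64.\<close>

lemma psi_remainder: "\<bar>psi b - psi a - psi' a * (b - a)\<bar> \<le> 64 * (b - a)\<^sup>2"
proof -
  define d where "d c = (max 0 (b - c))\<^sup>2 - (max 0 (a - c))\<^sup>2 - 2 * max 0 (a - c) * (b - a)" for c :: real
  have d: "0 \<le> d c" "d c \<le> (b - a)\<^sup>2" for c
    using max_sq_remainder[of "b - c" "a - c"] by (auto simp: d_def)
  have "psi b - psi a - psi' a * (b - a) = 32 * (d (1/4) - 2 * d (3/8) + d (1/2))"
    unfolding psi_def psi'_def d_def by (simp add: algebra_simps)
  moreover have "\<bar>32 * (u - 2 * v + w)\<bar> \<le> 64 * s"
    if "0 \<le> u" "u \<le> s" "0 \<le> v" "v \<le> s" "0 \<le> w" "w \<le> s" for u v w s :: real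
    using that by (simp add: abs_le_iff)
  ultimately show ?thesis using d by metis
qed

lemma arctan_abs_le: "\<bar>arctan t\<bar> \<le> 2"
  using arctan_lbound[of t] arctan_ubound[of t] pi_less_4 by linarith

lemma arctan_mean_value:
  obtains c where "\<bar>c - a\<bar> \<le> \<bar>b - a\<bar>" "arctan b - arctan a = (b - a) / (1 + c\<^sup>2)"
proof (cases a b rule: linorder_cases)
  case less
  then obtain c where "a < c" "c < b" "arctan b - arctan a = (b - a) * inverse (1 + c\<^sup>2)"
    using MVT2[of a b arctan "\<lambda>c. inverse (1 + c\<^sup>2)"] DERIV_arctan by blast
  then show ?thesis by (intro that[of c]) (auto simp: divide_inverse)
next
  case greater
  then obtain c where "b < c" "c < a" "arctan a - arctan b = (a - b) * inverse (1 + c\<^sup>2)"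
    using MVT2[of b a arctan "\<lambda>c. inverse (1 + c\<^sup>2)"] DERIV_arctan by blast
  then show ?thesis by (intro that[of c]) (auto simp: divide_inverse algebra_simps)
qed (use that in auto)

lemma inverse_one_plus_sq_bounds: "0 < 1 / (1 + a\<^sup>2)" "1 / (1 + a\<^sup>2) \<le> (1::real)"
  by (auto simp: add_pos_nonneg divide_le_eq)

lemma arctan_lipschitz: "\<bar>arctan b - arctan a\<bar> \<le> \<bar>b - a\<bar>"
proof -
  obtain c where "arctan b - arctan a = (b - a) * (1 / (1 + c\<^sup>2))"
    using arctan_mean_value[of a b] by auto
  then show ?thesis
    using inverse_one_plus_sq_bounds[of c] by (simp add: abs_mult mult_left_le del: times_divide_eq_right)
qed

text \<open>By the mean value theorem the error is \<open>b - a\<close> times a difference of values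
  of \<open>1 / (1 + t\<^sup>2)\<close> at points no further apart than \<open>a\<close> and
  \<open>b\<close>, and this function is 1-Lipschitz.\<close>

lemma arctan_remainder: "\<bar>arctan b - arctan a - (b - a) / (1 + a\<^sup>2)\<bar> \<le> (b - a)\<^sup>2"
proof -
  obtain c where c: "\<bar>c - a\<bar> \<le> \<bar>b - a\<bar>" "arctan b - arctan a = (b - a) / (1 + c\<^sup>2)"
    using arctan_mean_value[of a b] by auto
  have p: "0 < 1 + a\<^sup>2" "0 < 1 + c\<^sup>2" by (auto simp: add_pos_nonneg)
  have "\<bar>a + c\<bar> \<le> (1 + a\<^sup>2) * (1 + c\<^sup>2)"
  proof -
    have "\<bar>a\<bar> \<le> 1 + a\<^sup>2" for a :: real
    proof -
      have "0 \<le> (\<bar>a\<bar> - 1/2)\<^sup>2" by simp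
      then show ?thesis by (simp add: power2_eq_square algebra_simps)
    qed
    have h: "2 * \<bar>t\<bar> \<le> 1 + t\<^sup>2" for t :: real
    proof -
      have "0 \<le> (\<bar>t\<bar> - 1)\<^sup>2" by simp
      then show ?thesis by (simp add: power2_eq_square algebra_simps)
    qed
    have "(1 + a\<^sup>2) * (1 + c\<^sup>2) \<ge> (1 + a\<^sup>2) + c\<^sup>2"
      by (simp add: algebra_simps)
    then show ?thesis using h[of a] h[of c] zero_le_power2[of a] zero_le_power2[of c] by linarith
  qed
  then have "\<bar>(a + c) / ((1 + a\<^sup>2) * (1 + c\<^sup>2))\<bar> \<le> 1"
    using p by (simp add: divide_le_eq abs_mult)
  moreover have "1 / (1 + c\<^sup>2) - 1 / (1 + a\<^sup>2) = (a - c) * ((a + c) / ((1 + a\<^sup>2) * (1 + c\<^sup>2)))"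
    using p by (simp add: divide_simps power2_eq_square) (simp add: algebra_simps)
  ultimately have "\<bar>1 / (1 + c\<^sup>2) - 1 / (1 + a\<^sup>2)\<bar> \<le> \<bar>a - c\<bar> * 1"
    unfolding abs_mult by (metis abs_ge_zero abs_mult mult_left_mono)
  then have "\<bar>1 / (1 + c\<^sup>2) - 1 / (1 + a\<^sup>2)\<bar> \<le> \<bar>b - a\<bar>"
    using c(1) by (simp add: abs_minus_commute)
  moreover have "arctan b - arctan a - (b - a) / (1 + a\<^sup>2)
      = (b - a) * (1 / (1 + c\<^sup>2) - 1 / (1 + a\<^sup>2))"
    using c(2) by (simp add: algebra_simps)
  ultimately show ?thesis
    by (simp add: abs_mult mult_left_mono power2_eq_square abs_mult_self_eq[symmetric, of "b - a"]
        del: abs_mult_self_eq)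
qed

text \<open>The constant \<open>1/20\<close> puts the minimiser at the rational point \<open>2\<close>, since \<open>2 (1 + 2\<^sup>2) = 10\<close>.\<close>

lemma regularised_arctan_min: "2\<^sup>2 / 20 - arctan 2 \<le> t\<^sup>2 / 20 - arctan t"
proof -
  let ?h = "\<lambda>t::real. t\<^sup>2 / 20 - arctan t"
  have d: "(?h has_real_derivative (t * (1 + t\<^sup>2) - 10) / (10 * (1 + t\<^sup>2))) (at t)" for t
  proof -
    have "1 + t\<^sup>2 \<noteq> 0" by (metis add_pos_nonneg less_irrefl zero_le_power2 zero_less_one)
    then show ?thesis
      by (auto intro!: derivative_eq_intros simp: divide_simps) (simp add: algebra_simps)
  qed
  have p: "0 < 1 + t\<^sup>2" for t :: real by (auto simp: add_pos_nonneg)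
  \<comment> \<open>The quadratic cofactor is positive, so the derivative changes sign only at
    2.\<close>
  have m: "t * (1 + t\<^sup>2) - 10 = (t - 2) * ((t + 1)\<^sup>2 + 4)" for t :: real
    by (simp add: power2_eq_square algebra_simps)
  have q: "0 \<le> (t + 1)\<^sup>2 + 4" for t :: real by simp
  show ?thesis
  proof (cases "t \<le> 2")
    case True
    then show ?thesis
    proof (rule DERIV_nonpos_imp_nonincreasing)
      fix x :: real assume "x \<le> 2"
      then have "(x * (1 + x\<^sup>2) - 10) / (10 * (1 + x\<^sup>2)) \<le> 0"
        unfolding m using p[of x] q[of x] by (intro divide_nonpos_pos mult_nonpos_nonneg) auto
      with d show "\<exists>y. (?h has_real_derivative y) (at x) \<and> y \<le> 0" by blast
    qed
  next
    case False
    then have "2 \<le> t" by simp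
    then show ?thesis
    proof (rule DERIV_nonneg_imp_nondecreasing)
      fix x :: real assume "2 \<le> x"
      then have "(x * (1 + x\<^sup>2) - 10) / (10 * (1 + x\<^sup>2)) \<ge> 0"
        unfolding m using p[of x] q[of x] by (intro divide_nonneg_pos mult_nonneg_nonneg) auto
      with d show "\<exists>y. (?h has_real_derivative y) (at x) \<and> y \<ge> 0" by blast
    qed
  qed
qed

text \<open>The value 3/4 lies below pi/4 and above the level 1/2 at which a block counts as
  complete; the gap of 1/4 becomes the gradient lower bound.\<close>

lemma arctan_ge_three_quarters: "1 \<le> t \<Longrightarrow> 3/4 \<le> arctan t"
  using arctan_monotone'[of 1 t] arctan_one pi_gt3 by simp

subsection \<open>The hard function\<close>

text \<open>
  \<open>Y e x i\<close> is the chain variable of block \<open>i\<close>, and \<open>dchain y i\<close> is the partial derivative of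
  \<open>- (\<Sum>i<T. pre y i * (y i + 2))\<close> in \<open>y i\<close>. Since \<open>y i \<ge> - 2\<close> always holds, both summands of
  \<open>dchain\<close> are nonpositive and cannot cancel. Coordinates from \<open>T * n\<close> on are ignored.
\<close>

locale sign_chain =
  fixes D n T :: nat and A b :: real
  assumes n_pos: "n > 0" and T_pos: "T > 0" and dim: "T * n \<le> D" and A_pos: "A > 0" and b_pos: "b > 0"
begin

definition block :: "nat \<Rightarrow> nat set" where
  "block i = {i * n..<i * n + n}"

definition Y :: "rvec \<Rightarrow> rvec \<Rightarrow> nat \<Rightarrow> real" where
  "Y e x i = (\<Sum>k\<in>block i. e k * arctan (b * x k)) / n"

definition pre :: "rvec \<Rightarrow> nat \<Rightarrow> real" where
  "pre y i = (if i = 0 then 1 else psi (y (i - 1)))"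

definition dchain :: "rvec \<Rightarrow> nat \<Rightarrow> real" where
  "dchain y i = - pre y i - (if Suc i < T then psi' (y i) * (y (Suc i) + 2) else 0)"

definition F :: "rvec \<Rightarrow> rvec \<Rightarrow> real" where
  "F e x = A * ((\<Sum>k<T * n. (b * x k)\<^sup>2 / 20) / n - (\<Sum>i<T. pre (Y e x) i * (Y e x i + 2)))"

definition g :: "rvec \<Rightarrow> rvec \<Rightarrow> rvec" where
  "g e x = (\<lambda>k\<in>{..<D}. if k < T * n
     then A * b / n * (dchain (Y e x) (k div n) * e k / (1 + (b * x k)\<^sup>2) + b * x k / 10) else 0)"

text \<open>The default 0 keeps the set finite and agrees with the marker for an unknown sign in
  truncations. Most estimates below ask only for absolute values at most 1, so that they also apply
  to truncated signs.\<close>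

definition signs :: "rvec set" where
  "signs = PiE_dflt {..<T * n} 0 (\<lambda>_. {-1, 1})"

lemma g_space [simp]: "g e x \<in> space (RD D)"
  by (simp add: g_def space_PiM)

lemma finite_block [simp]: "finite (block i)" and card_block [simp]: "card (block i) = n"
  by (auto simp: block_def)

lemma block_div: "k \<in> block i \<Longrightarrow> k div n = i"
  by (auto simp: block_def intro!: div_nat_eqI simp: mult.commute)

lemma mem_block: "k \<in> block (k div n)"
  using n_pos dividend_less_times_div[of n k] by (auto simp: block_def mult.commute add.commute)

lemma block_less: "i < T \<Longrightarrow> k \<in> block i \<Longrightarrow> k < T * n"
proof -
  assume "i < T" "k \<in> block i"
  then have "Suc i * n \<le> T * n" "k < Suc i * n" by (auto simp: block_def simp del: mult_Suc intro!: mult_le_mono1) simp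
  then show ?thesis by linarith
qed

lemma sum_blocks: "(\<Sum>i<T. \<Sum>k\<in>block i. h k) = (\<Sum>k<T * n. h k)" for h :: "nat \<Rightarrow> real"
  unfolding block_def by (rule sum.nat_group)

lemma sum_blocks_le: "(\<Sum>i<T. \<Sum>k\<in>block i. h k) \<le> (\<Sum>k<D. h k)"
  if "\<And>k. 0 \<le> h k" for h :: "nat \<Rightarrow> real"
  unfolding sum_blocks using dim that by (intro sum_mono2) auto

lemma Y_bound: "\<bar>Y e x i\<bar> \<le> 2" if "\<And>k. \<bar>e k\<bar> \<le> 1"
proof -
  have "\<bar>\<Sum>k\<in>block i. e k * arctan (b * x k)\<bar> \<le> (\<Sum>k\<in>block i. \<bar>e k * arctan (b * x k)\<bar>)"
    by (rule sum_abs)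
  also have "\<dots> \<le> (\<Sum>k\<in>block i. 1 * 2)"
    unfolding abs_mult by (intro sum_mono mult_mono) (auto simp: that arctan_abs_le)
  also have "\<dots> = 2 * n" by simp
  finally show ?thesis using n_pos by (simp add: Y_def divide_le_eq)
qed

lemma pre_bounds: "0 \<le> pre y i" "pre y i \<le> 1"
  by (auto simp: pre_def psi_bounds)

lemma dchain_bounds:
  assumes "\<And>i. \<bar>y i\<bar> \<le> 2"
  shows "dchain y i \<le> - pre y i" and "\<bar>dchain y i\<bar> \<le> 33"
proof -
  have s: "0 \<le> y (Suc i) + 2" "y (Suc i) + 2 \<le> 4" using assms[of "Suc i"] by auto
  have "0 \<le> psi' (y i) * (y (Suc i) + 2)" using s psi'_bounds[of "y i"] by auto
  moreover have "psi' (y i) * (y (Suc i) + 2) \<le> 8 * 4"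
    using s psi'_bounds[of "y i"] by (intro mult_mono) auto
  ultimately show "dchain y i \<le> - pre y i" "\<bar>dchain y i\<bar> \<le> 33"
    using pre_bounds[of y i] by (auto simp: dchain_def)
qed

text \<open>Only neighbouring blocks interact. The remainder \<open>q i\<close> of the product
  \<open>psi (y i) * (y (Suc i) + 2)\<close> has constant 64 * 4 + 8 / 2 = 260, and each block
  occurs in at most two such products, which gives 520 independently of \<open>T\<close>.\<close>

lemma chain_remainder:
  assumes z: "\<And>i. \<bar>z i\<bar> \<le> 2"
  shows "\<bar>(\<Sum>i<T. pre z i * (z i + 2)) - (\<Sum>i<T. pre y i * (y i + 2))
      + (\<Sum>i<T. dchain y i * (z i - y i))\<bar> \<le> 520 * (\<Sum>i<T. (z i - y i)\<^sup>2)"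
proof -
  obtain t where t: "T = Suc t" using T_pos by (cases T) auto
  define q where "q i = psi (z i) * (z (Suc i) + 2) - psi (y i) * (y (Suc i) + 2)
      - psi (y i) * (z (Suc i) - y (Suc i)) - psi' (y i) * (y (Suc i) + 2) * (z i - y i)" for i
  have q: "\<bar>q i\<bar> \<le> 260 * ((z i - y i)\<^sup>2 + (z (Suc i) - y (Suc i))\<^sup>2)" for i
  proof -
    define u v where "u = z i - y i" and "v = z (Suc i) - y (Suc i)"
    have "q i = (psi (z i) - psi (y i) - psi' (y i) * u) * (z (Suc i) + 2) + psi' (y i) * (u * v)"
      by (simp add: q_def u_def v_def algebra_simps)
    also have "\<bar>\<dots>\<bar> \<le> \<bar>psi (z i) - psi (y i) - psi' (y i) * u\<bar> * \<bar>z (Suc i) + 2\<bar> + \<bar>psi' (y i)\<bar> * \<bar>u * v\<bar>"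
      by (metis abs_mult abs_triangle_ineq)
    also have "\<dots> \<le> (64 * u\<^sup>2) * 4 + 8 * ((u\<^sup>2 + v\<^sup>2) / 2)"
    proof (intro add_mono mult_mono)
      show "\<bar>psi (z i) - psi (y i) - psi' (y i) * u\<bar> \<le> 64 * u\<^sup>2"
        unfolding u_def by (rule psi_remainder)
      show "\<bar>z (Suc i) + 2\<bar> \<le> 4" using z[of "Suc i"] by linarith
      show "\<bar>psi' (y i)\<bar> \<le> 8" using psi'_bounds[of "y i"] by simp
      show "\<bar>u * v\<bar> \<le> (u\<^sup>2 + v\<^sup>2) / 2"
        using zero_le_power2[of "\<bar>u\<bar> - \<bar>v\<bar>"] unfolding abs_mult
        by (simp add: power2_diff)
    qed auto
    also have "\<dots> \<le> 260 * (u\<^sup>2 + v\<^sup>2)" using zero_le_power2[of v] by (simp add: field_simps)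
    finally show ?thesis unfolding u_def v_def .
  qed
  have p: "(\<Sum>i<T. pre u i * (u i + 2)) = u 0 + 2 + (\<Sum>i<t. psi (u i) * (u (Suc i) + 2))" for u
    unfolding t sum.lessThan_Suc_shift by (simp add: pre_def)
  have d1: "(\<Sum>i<T. pre y i * (z i - y i)) = z 0 - y 0 + (\<Sum>i<t. psi (y i) * (z (Suc i) - y (Suc i)))"
    unfolding t sum.lessThan_Suc_shift by (simp add: pre_def)
  have d2: "(\<Sum>i<T. (if Suc i < T then psi' (y i) * (y (Suc i) + 2) else 0) * (z i - y i))
      = (\<Sum>i<t. psi' (y i) * (y (Suc i) + 2) * (z i - y i))"
    unfolding t sum.lessThan_Suc by simp
  have d: "(\<Sum>i<T. dchain y i * (z i - y i)) =
      - (\<Sum>i<T. pre y i * (z i - y i))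
      - (\<Sum>i<T. (if Suc i < T then psi' (y i) * (y (Suc i) + 2) else 0) * (z i - y i))"
    unfolding dchain_def left_diff_distrib sum_subtractf by (simp add: sum_negf)
  have eq: "(\<Sum>i<T. pre z i * (z i + 2)) - (\<Sum>i<T. pre y i * (y i + 2)) + (\<Sum>i<T. dchain y i * (z i - y i))
      = (\<Sum>i<t. q i)"
    unfolding p d d1 d2 q_def sum_subtractf by simp
  have "\<bar>\<Sum>i<t. q i\<bar> \<le> (\<Sum>i<t. 260 * ((z i - y i)\<^sup>2 + (z (Suc i) - y (Suc i))\<^sup>2))"
    by (intro order_trans[OF sum_abs] sum_mono q)
  also have "\<dots> = 260 * (\<Sum>i<t. (z i - y i)\<^sup>2) + 260 * (\<Sum>i<t. (z (Suc i) - y (Suc i))\<^sup>2)"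
    by (simp add: sum.distrib sum_distrib_left distrib_left)
  also have "\<dots> \<le> 260 * (\<Sum>i<T. (z i - y i)\<^sup>2) + 260 * (\<Sum>i<T. (z i - y i)\<^sup>2)"
  proof (intro add_mono mult_left_mono)
    show "(\<Sum>i<t. (z i - y i)\<^sup>2) \<le> (\<Sum>i<T. (z i - y i)\<^sup>2)" unfolding t by simp
    show "(\<Sum>i<t. (z (Suc i) - y (Suc i))\<^sup>2) \<le> (\<Sum>i<T. (z i - y i)\<^sup>2)"
      unfolding t sum.lessThan_Suc_shift by simp
  qed auto
  finally show ?thesis unfolding eq by simp
qed

text \<open>Chain rule with error terms, all measured by \<open>s\<close>: 520 from the chain, 33
  from linearising \<open>Y\<close> (the bound on \<open>dchain\<close>), and at most 1 from the
  quadratic term, whose remainder is exactly \<open>s / 20\<close>.\<close>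

lemma F_remainder:
  assumes e: "\<And>k. \<bar>e k\<bar> \<le> 1"
  shows "\<bar>F e x' - F e x - (\<Sum>k<D. g e x k * (x' k - x k))\<bar> \<le> 554 * A * b\<^sup>2 / n * (dist_RD D x' x)\<^sup>2"
proof -
  define w where "w k = b * x' k - b * x k" for k
  define d where "d i = (\<Sum>k\<in>block i. (w k)\<^sup>2) / n" for i
  define l where "l i = (\<Sum>k\<in>block i. e k * (w k / (1 + (b * x k)\<^sup>2))) / n" for i
  define s where "s = (\<Sum>i<T. d i)"
  define y z where "y = Y e x" and "z = Y e x'"
  have Yl: "\<bar>z i - y i - l i\<bar> \<le> d i" for i
  proof -
    have "z i - y i - l i = (\<Sum>k\<in>block i. e k * (arctan (b * x' k) - arctan (b * x k)
        - w k / (1 + (b * x k)\<^sup>2))) / n"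
      unfolding y_def z_def Y_def l_def diff_divide_distrib[symmetric] sum_subtractf[symmetric]
        right_diff_distrib ..
    also have "\<bar>\<dots>\<bar> \<le> (\<Sum>k\<in>block i. 1 * (w k)\<^sup>2) / n"
      unfolding abs_divide abs_of_nat
      by (intro divide_right_mono order_trans[OF sum_abs] sum_mono, unfold abs_mult w_def)
        ((intro mult_mono arctan_remainder e; simp)+, simp)
    finally show ?thesis by (simp add: d_def)
  qed
  have Y2: "(z i - y i)\<^sup>2 \<le> d i" for i
  proof -
    have "z i - y i = (\<Sum>k\<in>block i. e k * (arctan (b * x' k) - arctan (b * x k))) / n"
      unfolding y_def z_def Y_def diff_divide_distrib[symmetric] sum_subtractf[symmetric]
        right_diff_distrib ..
    also have "\<bar>\<dots>\<bar> \<le> (\<Sum>k\<in>block i. 1 * \<bar>w k\<bar>) / n"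
      unfolding abs_divide abs_of_nat
      by (intro divide_right_mono order_trans[OF sum_abs] sum_mono, unfold abs_mult w_def)
        ((intro mult_mono arctan_lipschitz e; simp)+, simp)
    finally have "(z i - y i)\<^sup>2 \<le> ((\<Sum>k\<in>block i. 1 * \<bar>w k\<bar>) / n)\<^sup>2"
      using power_mono[of "\<bar>z i - y i\<bar>" _ 2] by simp
    \<comment> \<open>The square of a mean is at most the mean of the squares, so averaging over a
      block loses no factor \<open>n\<close>.\<close>
    also have "\<dots> \<le> (n * (\<Sum>k\<in>block i. (w k)\<^sup>2)) / (real n)\<^sup>2"
      using Cauchy_Schwarz_ineq_sum[of "\<lambda>_. 1" "\<lambda>k. \<bar>w k\<bar>" "block i"]
      unfolding power_divide by (intro divide_right_mono) auto
    also have "\<dots> = d i" using n_pos by (simp add: d_def power2_eq_square)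
    finally show ?thesis .
  qed
  have s2: "(\<Sum>i<T. (z i - y i)\<^sup>2) \<le> s" unfolding s_def by (intro sum_mono Y2)
  define P where "P = (\<Sum>k<T * n. b * x k / 10 * w k) / n"
  have G: "(\<Sum>k<D. g e x k * (x' k - x k)) = A * ((\<Sum>i<T. dchain y i * l i) + P)"
  proof -
    have "(\<Sum>k<D. g e x k * (x' k - x k)) = (\<Sum>k<T * n. g e x k * (x' k - x k))"
      using dim by (intro sum.mono_neutral_right) (auto simp: g_def)
    also have "\<dots> = (\<Sum>k<T * n. A * (dchain y (k div n) * (e k * (w k / (1 + (b * x k)\<^sup>2))) / n
        + b * x k / 10 * w k / n))"
    proof (intro sum.cong refl)
      fix k assume "k \<in> {..<T * n}"
      then have k: "k < T * n" "k < D" using dim by auto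
      show "g e x k * (x' k - x k) = A * (dchain y (k div n) * (e k * (w k / (1 + (b * x k)\<^sup>2))) / n
        + b * x k / 10 * w k / n)"
        using k unfolding g_def w_def y_def divide_inverse
        by (simp add: algebra_simps)
    qed
    also have "\<dots> = A * ((\<Sum>k<T * n. dchain y (k div n) * (e k * (w k / (1 + (b * x k)\<^sup>2))) / n) + P)"
      unfolding P_def by (simp only: sum_distrib_left[symmetric] sum.distrib sum_divide_distrib)
    also have "(\<Sum>k<T * n. dchain y (k div n) * (e k * (w k / (1 + (b * x k)\<^sup>2))) / n)
       = (\<Sum>i<T. dchain y i * l i)"
      unfolding sum_blocks[symmetric] l_def sum_distrib_left sum_divide_distrib
      by (intro sum.cong refl) (simp add: block_div)
    finally show ?thesis .
  qed
  define U where "U x = (\<Sum>k<T * n. (b * x k)\<^sup>2 / 20) / n" for x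
  have R: "U x' - U x - P = s / 20"
  proof -
    have "s / 20 = (\<Sum>k<T * n. (w k)\<^sup>2 / 20) / n"
      by (simp add: s_def d_def sum_divide_distrib[symmetric] sum_blocks)
    moreover have "(w k)\<^sup>2 / 20 = (b * x' k)\<^sup>2 / 20 - (b * x k)\<^sup>2 / 20 - b * x k / 10 * w k" for k
      unfolding w_def by (simp add: power2_eq_square field_simps)
    ultimately show ?thesis unfolding U_def P_def diff_divide_distrib[symmetric] sum_subtractf[symmetric]
      by simp
  qed
  define c where "c = (\<Sum>i<T. dchain y i * (z i - y i))"
  define cz cy cl where "cz = (\<Sum>i<T. pre z i * (z i + 2))" and "cy = (\<Sum>i<T. pre y i * (y i + 2))"
    and "cl = (\<Sum>i<T. dchain y i * l i)"
  have ch: "\<bar>cz - cy + c\<bar> \<le> 520 * s"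
    using chain_remainder[of z y] Y_bound[OF e] s2 unfolding cz_def cy_def c_def z_def by fastforce
  have "\<bar>c - cl\<bar> \<le> (\<Sum>i<T. 33 * d i)"
    unfolding c_def cl_def sum_subtractf[symmetric] right_diff_distrib[symmetric]
  proof (intro order_trans[OF sum_abs] sum_mono, unfold abs_mult, intro mult_mono Yl)
    show "\<bar>dchain y i\<bar> \<le> 33" for i unfolding y_def by (intro dchain_bounds Y_bound e)
  qed auto
  then have dl: "\<bar>c - cl\<bar> \<le> 33 * s"
    by (simp add: s_def sum_distrib_left)
  have s0: "0 \<le> s" unfolding s_def d_def by (intro sum_nonneg divide_nonneg_nonneg) auto
  have "F e x' - F e x - (\<Sum>k<D. g e x k * (x' k - x k)) =
     A * ((c - cl) - (cz - cy + c) + s / 20)"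
    unfolding F_def G R[symmetric] U_def cz_def cy_def cl_def[symmetric] z_def[symmetric] y_def[symmetric]
    by (simp add: algebra_simps)
  also have "\<bar>\<dots>\<bar> \<le> A * (554 * s)"
    unfolding abs_mult using A_pos ch dl s0 by (intro mult_mono) auto
  also have "\<dots> \<le> A * (554 * (b\<^sup>2 / n * (dist_RD D x' x)\<^sup>2))"
  proof -
    have "s = b\<^sup>2 / n * (\<Sum>i<T. \<Sum>k\<in>block i. (x' k - x k)\<^sup>2)"
      by (simp add: s_def d_def w_def right_diff_distrib[symmetric] power_mult_distrib sum_distrib_left sum_divide_distrib)
    also have "\<dots> \<le> b\<^sup>2 / n * (dist_RD D x' x)\<^sup>2"
      unfolding norm_RD_sq by (intro mult_left_mono sum_blocks_le) auto
    finally show ?thesis using A_pos by (intro mult_left_mono) auto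
  qed
  finally show ?thesis by (simp add: mult_ac)
qed

lemma smooth_F: "smooth_RD D (6 * (554 * A * b\<^sup>2 / n)) (F e)"
  and grad_F: "x \<in> space (RD D) \<Longrightarrow> grad D (F e) x = g e x" if "\<And>k. \<bar>e k\<bar> \<le> 1"
proof -
  have "0 \<le> 554 * A * b\<^sup>2 / n" using A_pos by simp
  note q = quadratic_remainder_imp_smooth[OF this g_space F_remainder[OF that]]
  show "smooth_RD D (6 * (554 * A * b\<^sup>2 / n)) (F e)" by (rule q(1))
  show "grad D (F e) x = g e x" if "x \<in> space (RD D)" using that by (rule q(2))
qed

end

text \<open>For \<open>a \<ge> 1\<close> the left side is not positive. Otherwise the slope is at
  most -1/10: near 0 the arctan term dominates, and for \<open>a < -1\<close> the regulariser alone
  suffices. The left side is at most (3/4 + 2) / 275 = 1/100. A bound by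
  \<open>3/4 - arctan a\<close> is chosen because it can be summed over a block to give
  \<open>Y\<close>.\<close>

lemma chain_slope_bound:
  fixes a d :: real
  assumes "d \<le> -1"
  shows "(3/4 - arctan a) / 275 \<le> (d / (1 + a\<^sup>2) + a / 10)\<^sup>2"
proof (cases "a \<ge> 1")
  case True
  then show ?thesis using arctan_ge_three_quarters[of a] by (simp add: order_trans[of _ 0])
next
  case False
  have p: "0 < 1 + a\<^sup>2" by (auto simp: add_pos_nonneg)
  have "d / (1 + a\<^sup>2) + a / 10 \<le> - (1/10)"
  proof (cases "a \<ge> -1")
    case True
    then have "a\<^sup>2 \<le> 1" using False by (auto simp: abs_square_le_1 abs_le_iff)
    then have "d / (1 + a\<^sup>2) \<le> - (1/2)" using assms p by (simp add: divide_le_eq field_simps)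
    then show ?thesis using False by simp
  next
    case False
    moreover have "d / (1 + a\<^sup>2) \<le> 0" using assms p by (simp add: divide_nonpos_pos)
    ultimately show ?thesis by simp
  qed
  then have "(1/10)\<^sup>2 \<le> (- (d / (1 + a\<^sup>2) + a / 10))\<^sup>2" by (intro power_mono) auto
  then have "1/100 \<le> (d / (1 + a\<^sup>2) + a / 10)\<^sup>2" by (simp only: power2_minus) (simp add: power2_eq_square)
  then show ?thesis using arctan_abs_le[of a] by simp
qed

section \<open>Minimum value and gradient size of the hard function\<close>

context sign_chain
begin

definition bigmin :: "rvec \<Rightarrow> rvec" where
  "bigmin e = (\<lambda>k\<in>{..<D}. if k < T * n then 2 * e k / b else 0)"

lemma signsD: "e \<in> signs \<Longrightarrow> k < T * n \<Longrightarrow> e k = 1 \<or> e k = -1"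
  by (auto simp: signs_def PiE_dflt_def)

lemma signs_abs_le: "e \<in> signs \<Longrightarrow> \<bar>e k\<bar> \<le> 1"
  by (cases "k < T * n") (auto simp: signs_def PiE_dflt_def)

lemma sign_arctan: "s = 1 \<or> s = -1 \<Longrightarrow> s * arctan t = arctan (s * t)" for s t :: real
  by (auto simp: arctan_minus)

lemma sign_sq: "s = 1 \<or> s = -1 \<Longrightarrow> (s * t)\<^sup>2 = t\<^sup>2" for s t :: real
  by auto

text \<open>Replacing every factor \<open>pre\<close> by 1 can only decrease the function, because
  \<open>Y + 2\<close> is nonnegative; then the coordinates separate and
  \<open>regularised_arctan_min\<close> applies to each.\<close>

lemma F_lower_bound:
  assumes e: "e \<in> signs"
  shows "A * (real T * (1/5 - arctan 2 - 2)) \<le> F e x"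
proof -
  have "1/5 - arctan 2 - 2 \<le> (\<Sum>k\<in>block i. (b * x k)\<^sup>2 / 20) / n - (Y e x i + 2)" if i: "i < T" for i
  proof -
    have "(\<Sum>k\<in>block i. 1/5 - arctan 2) \<le> (\<Sum>k\<in>block i. (b * x k)\<^sup>2 / 20 - e k * arctan (b * x k))"
    proof (intro sum_mono)
      fix k assume "k \<in> block i"
      then have "e k = 1 \<or> e k = -1" using signsD[OF e] block_less[OF i] by blast
      then show "1/5 - arctan 2 \<le> (b * x k)\<^sup>2 / 20 - e k * arctan (b * x k)"
        using regularised_arctan_min[of "e k * (b * x k)"] by (simp add: sign_arctan sign_sq)
    qed
    then have "n * (1/5 - arctan 2) / n \<le> (\<Sum>k\<in>block i. (b * x k)\<^sup>2 / 20 - e k * arctan (b * x k)) / n"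
      by (intro divide_right_mono) auto
    then show ?thesis using n_pos by (simp add: Y_def diff_divide_distrib sum_subtractf)
  qed
  then have "(\<Sum>i<T. 1/5 - arctan 2 - 2) \<le> (\<Sum>i<T. (\<Sum>k\<in>block i. (b * x k)\<^sup>2 / 20) / n - (Y e x i + 2))"
    by (intro sum_mono) auto
  also have "\<dots> \<le> (\<Sum>i<T. (\<Sum>k\<in>block i. (b * x k)\<^sup>2 / 20) / n - pre (Y e x) i * (Y e x i + 2))"
  proof (intro sum_mono diff_left_mono)
    fix i
    have "0 \<le> Y e x i + 2" using Y_bound[of e x i, OF signs_abs_le[OF e]] by linarith
    then show "pre (Y e x) i * (Y e x i + 2) \<le> Y e x i + 2"
      using pre_bounds[of "Y e x" i] by (simp add: mult_left_le_one_le)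
  qed
  also have "\<dots> = (\<Sum>k<T * n. (b * x k)\<^sup>2 / 20) / n - (\<Sum>i<T. pre (Y e x) i * (Y e x i + 2))"
    unfolding sum_subtractf sum_divide_distrib[symmetric] sum_blocks ..
  finally show ?thesis unfolding F_def using A_pos by (intro mult_left_mono) auto
qed

text \<open>All inequalities of the lower bound are attained: each coordinate sits at the scalar
  minimiser, and \<open>arctan 2 \<ge> 3/4\<close> makes every \<open>pre\<close> equal to
  1.\<close>

lemma F_bigmin:
  assumes e: "e \<in> signs"
  shows "F e (bigmin e) = A * (real T * (1/5 - arctan 2 - 2))"
proof -
  have be: "b * bigmin e k = e k * 2" if "k < T * n" for k
    using that dim b_pos by (simp add: bigmin_def)
  have Yb: "Y e (bigmin e) i = arctan 2" if i: "i < T" for i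
  proof -
    have "(\<Sum>k\<in>block i. e k * arctan (b * bigmin e k)) = (\<Sum>k\<in>block i. arctan 2)"
    proof (intro sum.cong refl)
      fix k assume "k \<in> block i"
      then have "k < T * n" using block_less[OF i] by blast
      then show "e k * arctan (b * bigmin e k) = arctan 2"
        using signsD[OF e, of k] be by (auto simp: arctan_minus)
    qed
    then show ?thesis using n_pos by (simp add: Y_def)
  qed
  have "psi (arctan 2) = 1" using arctan_ge_three_quarters[of 2] by (intro psi_high) auto
  then have "pre (Y e (bigmin e)) i = 1" if "i < T" for i
    using that Yb[of "i - 1"] by (auto simp: pre_def)
  then have s1: "(\<Sum>i<T. pre (Y e (bigmin e)) i * (Y e (bigmin e) i + 2)) = T * (arctan 2 + 2)"
    using Yb by simp
  have "(b * bigmin e k)\<^sup>2 / 20 = 1/5" if "k < T * n" for k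
    using signsD[OF e that] be[OF that] by auto
  then have s2: "(\<Sum>k<T * n. (b * bigmin e k)\<^sup>2 / 20) / n = T / 5"
    using n_pos by simp
  show ?thesis unfolding F_def s1 s2 by (simp add: algebra_simps)
qed

lemma F_in_class:
  assumes e: "e \<in> signs"
    and H: "6 * (554 * A * b\<^sup>2 / n) = H" and \<Delta>: "4 * A * T \<le> \<Delta>"
  shows "F e \<in> nonconvex_class D H \<Delta>"
  unfolding nonconvex_class_def
proof (intro CollectI conjI bexI[of _ "bigmin e"] ballI)
  show "smooth_RD D H (F e)" using smooth_F[OF signs_abs_le[OF e]] unfolding H .
  show "bigmin e \<in> space (RD D)" by (simp add: bigmin_def space_PiM)
  show "F e (bigmin e) \<le> F e x" for x
    using F_lower_bound[OF e] F_bigmin[OF e] by simp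
  let ?o = "\<lambda>i\<in>{..<D}. 0"
  have Y0: "Y e ?o i = 0" if "i < T" for i
    using block_less[OF that] dim unfolding Y_def by (force intro!: sum.neutral)
  have "0 \<le> (\<Sum>i<T. pre (Y e ?o) i * (Y e ?o i + 2))"
    using pre_bounds by (intro sum_nonneg mult_nonneg_nonneg) (auto simp: Y0)
  moreover have "(\<Sum>k<T * n. (b * ?o k)\<^sup>2 / 20) = 0" using dim by (intro sum.neutral) auto
  ultimately have "F e ?o \<le> 0" unfolding F_def using A_pos by (simp add: mult_nonneg_nonneg del: restrict_apply)
  \<comment> \<open>The factor 4 absorbs \<open>2 + arctan 2 - 1/5\<close>, with arctan bounded by
    2.\<close>
  moreover have "- (4 * A * T) \<le> A * (real T * (1/5 - arctan 2 - 2))"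
  proof -
    have "A * T * (- 4) \<le> A * T * (1/5 - arctan 2 - 2)"
      using A_pos arctan_abs_le[of 2] by (intro mult_left_mono) auto
    then show ?thesis by (simp add: mult_ac)
  qed
  ultimately show "F e ?o - F e (bigmin e) \<le> \<Delta>"
    using \<Delta> unfolding F_bigmin[OF e] by argo
qed

text \<open>In the first block \<open>i\<close> with variable below 1/2 the predecessor is complete,
  so \<open>pre\<close> is 1 and \<open>dchain \<le> -1\<close>. The slope bound summed over this
  block alone suffices.\<close>

lemma grad_lower_bound:
  assumes e: "e \<in> signs" and small: "Y e x (T - 1) < 1/2"
  shows "A * b / sqrt n / 34 \<le> norm_RD D (g e x)"
proof -
  define i where "i = (LEAST i. Y e x i < 1/2)"
  have Yi: "Y e x i < 1/2" unfolding i_def by (rule LeastI[of _ "T - 1"]) (rule small)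
  have "i \<le> T - 1" unfolding i_def by (rule Least_le) (rule small)
  then have iT: "i < T" using T_pos by simp
  have "pre (Y e x) i = 1"
  proof (cases i)
    case (Suc j)
    then have "\<not> Y e x j < 1/2" unfolding i_def by (intro not_less_Least) simp
    then show ?thesis using Suc by (simp add: pre_def psi_high)
  qed (simp add: pre_def)
  then have d: "dchain (Y e x) i \<le> -1"
    using dchain_bounds(1)[of "Y e x" i] Y_bound[OF signs_abs_le[OF e], where x=x] by simp
  have "(A * b / sqrt n / 34)\<^sup>2 = (A * b / n)\<^sup>2 * (n / 1156)"
    using n_pos by (simp add: power_divide power_mult_distrib power2_eq_square)
  \<comment> \<open>Here \<open>3/4 - Y e x i > 1/4\<close>, and 34^2 = 1156 exceeds 4 *
    275.\<close>
  also have "\<dots> \<le> (A * b / n)\<^sup>2 * (n * (3/4 - Y e x i) / 275)"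
    using Yi n_pos by (intro mult_left_mono) (auto simp: field_simps)
  also have "n * (3/4 - Y e x i) / 275 = (\<Sum>k\<in>block i. (3/4 - e k * arctan (b * x k)) / 275)"
  proof -
    have "n * Y e x i = (\<Sum>k\<in>block i. e k * arctan (b * x k))" using n_pos by (simp add: Y_def)
    then show ?thesis by (simp add: sum_subtractf sum_divide_distrib[symmetric] right_diff_distrib)
  qed
  also have "(A * b / n)\<^sup>2 * \<dots> \<le> (\<Sum>k\<in>block i. (g e x k)\<^sup>2)"
    unfolding sum_distrib_left
  proof (intro sum_mono)
    fix k assume k: "k \<in> block i"
    then have kT: "k < T * n" "k div n = i" using block_less[OF iT] block_div by auto
    then have s: "e k = 1 \<or> e k = -1" using signsD[OF e] by blast
    define w where "w = b * x k"
    have "(g e x k)\<^sup>2 = (A * b / n)\<^sup>2 * (dchain (Y e x) i * e k / (1 + w\<^sup>2) + w / 10)\<^sup>2"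
      using kT dim by (simp add: g_def w_def power_mult_distrib[symmetric])
    also have "dchain (Y e x) i * e k / (1 + w\<^sup>2) + w / 10
        = e k * (dchain (Y e x) i / (1 + (e k * w)\<^sup>2) + e k * w / 10)"
      using s by (elim disjE) simp_all
    finally have "(g e x k)\<^sup>2 = (A * b / n)\<^sup>2 * (dchain (Y e x) i / (1 + (e k * w)\<^sup>2) + e k * w / 10)\<^sup>2"
      unfolding sign_sq[OF s] .
    then show "(A * b / n)\<^sup>2 * ((3/4 - e k * arctan (b * x k)) / 275) \<le> (g e x k)\<^sup>2"
      unfolding sign_arctan[OF s] w_def
      by (simp only:) (intro mult_left_mono chain_slope_bound d zero_le_power2)
  qed
  also have "\<dots> \<le> (\<Sum>k<D. (g e x k)\<^sup>2)"
    using block_less[OF iT] dim by (intro sum_mono2) force+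
  also have "\<dots> = (norm_RD D (g e x))\<^sup>2" by (rule norm_RD_sq[symmetric])
  finally show ?thesis by (rule power2_le_imp_le) (rule L2_set_nonneg)
qed

section \<open>Truncated signs and the information contained in an answer\<close>

definition trunc :: "nat \<Rightarrow> rvec \<Rightarrow> rvec" where
  "trunc s e = (\<lambda>k. if k < s * n then e k else 0)"

text \<open>The threshold 1/4 is where \<open>psi\<close> and \<open>psi'\<close> start to be
  nonzero: from block \<open>prog e x\<close> on, no block activates its successor. Dependence on
  the first \<open>s\<close> blocks of signs is expressed as invariance under
  \<open>trunc s\<close>.\<close>

definition prog :: "rvec \<Rightarrow> rvec \<Rightarrow> nat" where
  "prog e x = (LEAST s. \<forall>i. s \<le> i \<and> i < T \<longrightarrow> Y e x i \<le> 1/4)"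

lemma trunc_abs_le: "(\<And>k. \<bar>e k\<bar> \<le> 1) \<Longrightarrow> \<bar>trunc s e k\<bar> \<le> 1"
  by (simp add: trunc_def)

lemma trunc_trunc: "trunc r (trunc s e) = trunc (min r s) e"
  by (rule ext) (simp add: trunc_def nat_mult_min_left)

lemma prog_le: "(\<And>i. s \<le> i \<Longrightarrow> i < T \<Longrightarrow> Y e x i \<le> 1/4) \<Longrightarrow> prog e x \<le> s"
  unfolding prog_def by (rule Least_le) auto

lemma Y_prog: "prog e x \<le> i \<Longrightarrow> i < T \<Longrightarrow> Y e x i \<le> 1/4"
proof -
  have "\<forall>i. prog e x \<le> i \<and> i < T \<longrightarrow> Y e x i \<le> 1/4"
    unfolding prog_def by (rule LeastI[of _ T]) auto
  then show "prog e x \<le> i \<Longrightarrow> i < T \<Longrightarrow> Y e x i \<le> 1/4" by blast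
qed

lemma block_less_iff: "k \<in> block i \<Longrightarrow> k < s * n \<longleftrightarrow> i < s"
  using block_div[of k i] n_pos by (metis div_less_iff_less_mult)

lemma trunc_block: "k \<in> block i \<Longrightarrow> trunc s e k = (if i < s then e k else 0)"
  by (simp add: trunc_def block_less_iff)

lemma Y_trunc: "Y (trunc s e) x i = (if i < s then Y e x i else 0)"
  unfolding Y_def by (auto simp: trunc_block cong: sum.cong)

text \<open>Block \<open>q\<close> can be active through block \<open>q - 1\<close>, so its signs
  are needed, whence \<open>q < s\<close>. In block \<open>s - 1\<close> the erased successor is
  multiplied by \<open>psi' = 0\<close>, and from block \<open>s\<close> on both sides
  vanish.\<close>

lemma dchain_trunc:
  assumes "\<And>i. q \<le> i \<Longrightarrow> i < T \<Longrightarrow> Y e x i \<le> 1/4" "q < s" "k < T * n"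
  shows "dchain (Y (trunc s e) x) (k div n) * trunc s e k = dchain (Y e x) (k div n) * e k"
proof -
  define i where "i = k div n"
  have k: "k \<in> block i" "i < T"
    using assms(3) mem_block n_pos by (auto simp: i_def less_mult_imp_div_less)
  show ?thesis
  proof (cases "i < s")
    case True
    have "psi' (Y e x i) = 0" if "\<not> Suc i < s"
      using assms(1)[of i] assms(2) that k(2) by (intro psi_low) simp
    then show ?thesis
      using True k less_imp_diff_less[OF True, of "Suc 0"] unfolding i_def[symmetric]
      by (cases "Suc i < s") (simp_all add: dchain_def pre_def Y_trunc trunc_block)
  next
    case False
    have "psi (Y e x (i - 1)) = 0" "psi' (Y e x i) = 0"
      using assms(1)[of "i - 1"] assms(1)[of i] False assms(2) k(2) by (auto intro!: psi_low)
    then show ?thesis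
      using False assms(2) k unfolding i_def[symmetric]
      by (auto simp: dchain_def pre_def trunc_block)
  qed
qed

lemma g_trunc:
  assumes "prog e x < s"
  shows "g (trunc s e) x = g e x"
  unfolding g_def using dchain_trunc[OF Y_prog assms] by (intro restrict_ext) auto

lemma prog_trunc:
  assumes "prog e x \<le> s"
  shows "prog (trunc s e) x = prog e x"
proof -
  have "(\<forall>i. r \<le> i \<and> i < T \<longrightarrow> (if i < s then Y e x i else 0) \<le> 1/4)
      \<longleftrightarrow> (\<forall>i. r \<le> i \<and> i < T \<longrightarrow> Y e x i \<le> 1/4)" for r
    using Y_prog[of e x] assms by (auto split: if_splits) (metis le_trans not_le)
  then show ?thesis unfolding prog_def Y_trunc by simp
qed

text \<open>
  With probability \<open>p\<close> (noise \<open>z = 1\<close>) the oracle reveals the block after \<open>prog e x\<close>; the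
  factor \<open>1 / p\<close> makes it unbiased.
\<close>

definition G :: "real \<Rightarrow> rvec \<Rightarrow> rvec \<times> real \<Rightarrow> rvec" where
  "G p e = (\<lambda>(x, z). \<lambda>k\<in>{..<D}. g (trunc (prog e x) e) x k +
     (if z = 1 then (g e x k - g (trunc (prog e x) e) x k) / p else 0))"

text \<open>An answer uses the signs of the blocks below \<open>prog e x\<close>, and those of block
  \<open>prog e x\<close> itself only if \<open>z = 1\<close>. This is the single unit of progress
  per success.\<close>

lemma G_trunc:
  assumes "prog e x \<le> s" "z = 1 \<Longrightarrow> prog e x < s"
  shows "G p (trunc s e) (x, z) = G p e (x, z)"
  using assms g_trunc[of e x s]
  by (auto simp: G_def prog_trunc trunc_trunc min_absorb1 intro!: restrict_ext)

text \<open>With \<open>q = prog e x\<close>, erasing from block \<open>q\<close> on affects only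
  the blocks \<open>q - 1\<close> and \<open>q\<close>: earlier ones do not see block
  \<open>q\<close>, later ones are inactive on both sides. Each entry changes by at most 33 + 33 =
  66 units, and 2 * 66^2 = 8712. The bound is free of \<open>T\<close>, which keeps the oracle
  variance small.\<close>

lemma grad_truncation_error:
  assumes e1: "\<And>k. \<bar>e k\<bar> \<le> 1"
  shows "(\<Sum>k<D. (g e x k - g (trunc (prog e x) e) x k)\<^sup>2) \<le> 8712 * (A * b)\<^sup>2 / n"
proof -
  define q where "q = prog e x"
  define h where "h k = g e x k - g (trunc q e) x k" for k
  define c where "c = 4356 * (A * b)\<^sup>2 / n"
  have c0: "0 \<le> c" by (simp add: c_def)
  have h: "h k = A * b / n * ((dchain (Y e x) i * e k - dchain (Y (trunc q e) x) i * trunc q e k) / (1 + (b * x k)\<^sup>2))"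
    if "i < T" "k \<in> block i" for i k
    using block_less[OF that] block_div[OF that(2)] dim
    by (simp add: h_def g_def algebra_simps diff_divide_distrib)
  have *: "(\<Sum>k\<in>block i. (h k)\<^sup>2) \<le> (if i = q - 1 \<or> i = q then c else 0)" if i: "i < T" for i
  proof -
    consider "i = q - 1 \<or> i = q" | "Suc i < q" | "q < i" by linarith
    then show ?thesis
    proof cases
      case 1
      have "(h k)\<^sup>2 \<le> (A * b / n * 66)\<^sup>2" if k: "k \<in> block i" for k
      proof -
        have "\<bar>dchain (Y e x) i * e k\<bar> \<le> 33 * 1" "\<bar>dchain (Y (trunc q e) x) i * trunc q e k\<bar> \<le> 33 * 1"
          unfolding abs_mult by (intro mult_mono dchain_bounds Y_bound trunc_abs_le e1; simp)+
        then have "\<bar>dchain (Y e x) i * e k - dchain (Y (trunc q e) x) i * trunc q e k\<bar> * (1 / (1 + (b * x k)\<^sup>2)) \<le> 66 * 1"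
          by (intro mult_mono inverse_one_plus_sq_bounds) auto
        then have "\<bar>(dchain (Y e x) i * e k - dchain (Y (trunc q e) x) i * trunc q e k) / (1 + (b * x k)\<^sup>2)\<bar> \<le> 66"
          by (simp add: abs_divide)
        then have "\<bar>h k\<bar> \<le> A * b / n * 66"
          unfolding h[OF i k] abs_mult using A_pos b_pos by (intro mult_mono) auto
        then show ?thesis using power_mono[of "\<bar>h k\<bar>" _ 2] by simp
      qed
      then have "(\<Sum>k\<in>block i. (h k)\<^sup>2) \<le> (\<Sum>k\<in>block i. (A * b / n * 66)\<^sup>2)"
        by (intro sum_mono)
      also have "\<dots> = c" using n_pos by (simp add: c_def power2_eq_square)
      finally show ?thesis using 1 by simp
    next
      case 2
      then have "h k = 0" if "k \<in> block i" for k
        unfolding h[OF i that] using that by (auto simp: Y_trunc trunc_block dchain_def pre_def)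
      then show ?thesis using c0 by simp
    next
      case 3
      then have "psi (Y e x (i - 1)) = 0" "psi' (Y e x i) = 0"
        using Y_prog[of e x "i - 1"] Y_prog[of e x i] i by (auto simp: q_def intro!: psi_low)
      then have "h k = 0" if "k \<in> block i" for k
        unfolding h[OF i that] using that 3 by (auto simp: trunc_block dchain_def pre_def)
      then show ?thesis using c0 by simp
    qed
  qed
  have "(\<Sum>k<D. (h k)\<^sup>2) = (\<Sum>k<T * n. (h k)\<^sup>2)"
    using dim by (intro sum.mono_neutral_right) (auto simp: h_def g_def)
  also have "\<dots> \<le> (\<Sum>i<T. if i = q - 1 \<or> i = q then c else 0)"
    unfolding sum_blocks[symmetric] by (intro sum_mono *) auto
  also have "\<dots> \<le> (\<Sum>i<T. (if i = q - 1 then c else 0) + (if i = q then c else 0))"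
    using c0 by (intro sum_mono) auto
  also have "\<dots> \<le> c + c" unfolding sum.distrib using c0 by (intro add_mono) auto
  finally show ?thesis by (simp add: h_def q_def c_def)
qed

end

subsection \<open>Oracle and measurability\<close>

lemma ic_visible_induct [case_names visible]:
  assumes "\<And>j. (\<And>j'. j' \<in> ic_visible M K j \<Longrightarrow> P j') \<Longrightarrow> P j"
  shows "P j"
proof -
  have "wf (inv_image (less_than <*lex*> less_than) (\<lambda>(m, k, r). (r, k)) :: (idx \<times> idx) set)"
    by auto
  then show ?thesis
  proof (induction j rule: wf_induct_rule)
    case (less j)
    show ?case by (rule assms, rule less) (auto simp: ic_visible_def split: prod.splits)
  qed
qed

lemma ic_visible_subset: "j \<in> ic_indices M K R \<Longrightarrow> ic_visible M K j \<subseteq> ic_indices M K R"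
  by (auto simp: ic_visible_def ic_indices_def)

lemma finite_ic_indices [simp]: "finite (ic_indices M K R)"
  and card_ic_indices: "card (ic_indices M K R) = M * (K * R)"
  by (simp_all add: ic_indices_def card_cartesian_product)

text \<open>Joint measurability in seed and noise is what allows the sum over signs to be exchanged
  with the expectation.\<close>

lemma ic_transcript_measurable:
  assumes alg: "ic_algorithm M K R D S query out" and G: "G \<in> RD D \<Otimes>\<^sub>M Z \<rightarrow>\<^sub>M RD D"
  shows "j \<in> ic_indices M K R \<Longrightarrow> (\<lambda>(w, z). ic_transcript M K query G w z j)
    \<in> S \<Otimes>\<^sub>M Pi\<^sub>M (ic_indices M K R) (\<lambda>_. Z) \<rightarrow>\<^sub>M RD D \<Otimes>\<^sub>M RD D"
proof (induction j rule: ic_visible_induct[of M K])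
  case (visible j)
  let ?N = "S \<Otimes>\<^sub>M Pi\<^sub>M (ic_indices M K R) (\<lambda>_. Z)"
  have IH: "(\<lambda>a. ic_transcript M K query G (fst a) (snd a) j') \<in> ?N \<rightarrow>\<^sub>M RD D \<Otimes>\<^sub>M RD D"
    if "j' \<in> ic_visible M K j" for j'
    using visible.IH[OF that] ic_visible_subset[OF visible.prems] that by (auto simp: split_beta')
  have "(\<lambda>a. \<lambda>j'\<in>ic_visible M K j. ic_transcript M K query G (fst a) (snd a) j')
      \<in> ?N \<rightarrow>\<^sub>M history_space D (ic_visible M K j)"
    by (intro measurable_restrict IH)
  moreover have "query j \<in> S \<Otimes>\<^sub>M history_space D (ic_visible M K j) \<rightarrow>\<^sub>M RD D"
    using alg visible.prems by (auto simp: ic_algorithm_def)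
  ultimately have q: "(\<lambda>a. query j (fst a, \<lambda>j'\<in>ic_visible M K j. ic_transcript M K query G (fst a) (snd a) j'))
      \<in> ?N \<rightarrow>\<^sub>M RD D"
    by (intro measurable_compose[OF measurable_Pair, of fst, OF measurable_fst])
  have z: "(\<lambda>a. snd a j) \<in> ?N \<rightarrow>\<^sub>M Z"
    using visible.prems by measurable
  have "(\<lambda>a. (query j (fst a, \<lambda>j'\<in>ic_visible M K j. ic_transcript M K query G (fst a) (snd a) j'),
      G (query j (fst a, \<lambda>j'\<in>ic_visible M K j. ic_transcript M K query G (fst a) (snd a) j'), snd a j)))
      \<in> ?N \<rightarrow>\<^sub>M RD D \<Otimes>\<^sub>M RD D"
    by (intro measurable_Pair q measurable_compose[OF measurable_Pair G] z)
  then show ?case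
    unfolding split_beta' by (subst ic_transcript.simps) (simp add: Let_def)
qed

lemma ic_output_measurable:
  assumes alg: "ic_algorithm M K R D S query out" and G: "G \<in> RD D \<Otimes>\<^sub>M Z \<rightarrow>\<^sub>M RD D"
  shows "(\<lambda>(w, z). ic_output M K R query out G w z)
    \<in> S \<Otimes>\<^sub>M Pi\<^sub>M (ic_indices M K R) (\<lambda>_. Z) \<rightarrow>\<^sub>M RD D"
proof -
  let ?N = "S \<Otimes>\<^sub>M Pi\<^sub>M (ic_indices M K R) (\<lambda>_. Z)"
  have "(\<lambda>a. \<lambda>j\<in>ic_indices M K R. ic_transcript M K query G (fst a) (snd a) j)
      \<in> ?N \<rightarrow>\<^sub>M history_space D (ic_indices M K R)"
    using ic_transcript_measurable[OF alg G] by (intro measurable_restrict) (auto simp: split_beta')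
  moreover have "out \<in> S \<Otimes>\<^sub>M history_space D (ic_indices M K R) \<rightarrow>\<^sub>M RD D"
    using alg by (auto simp: ic_algorithm_def)
  ultimately show ?thesis
    unfolding ic_output_def split_beta'
    by (intro measurable_compose[OF measurable_Pair, of fst, OF measurable_fst])
qed

lemma norm_RD_measurable [measurable]: "norm_RD D \<in> borel_measurable (RD D)"
  unfolding L2_set_def by measurable

text \<open>A Bernoulli variable coded as the reals 0 and 1, the noise type of oracles. Every set of
  reals is measurable for it.\<close>

definition noise :: "real \<Rightarrow> real measure" where
  "noise p = measure_pmf (map_pmf of_bool (bernoulli_pmf p))"

lemma sets_noise [simp, measurable_cong]: "sets (noise p) = sets (count_space UNIV)"
  by (simp add: noise_def)

lemma prob_space_noise: "prob_space (noise p)"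
  unfolding noise_def by unfold_locales simp

context sign_chain
begin

lemma Y_measurable: "i < T \<Longrightarrow> (\<lambda>x. Y e x i) \<in> borel_measurable (RD D)"
proof -
  assume i: "i < T"
  have "(\<lambda>x. x k) \<in> borel_measurable (RD D)" if "k \<in> block i" for k
    using block_less[OF i that] dim by (intro measurable_component_singleton) auto
  then show ?thesis unfolding Y_def
    by (intro borel_measurable_divide borel_measurable_sum borel_measurable_times
        measurable_compose[OF _ borel_measurable_arctan] borel_measurable_const) auto
qed

lemma psi_measurable [measurable]: "psi \<in> borel_measurable borel" "psi' \<in> borel_measurable borel"
  unfolding psi_def psi'_def by measurable

lemma dchain_measurable: "i < T \<Longrightarrow> (\<lambda>x. dchain (Y e x) i) \<in> borel_measurable (RD D)"
proof -
  assume i: "i < T"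
  have [measurable]: "(\<lambda>x. Y e x i) \<in> borel_measurable (RD D)" "(\<lambda>x. Y e x (i - 1)) \<in> borel_measurable (RD D)"
    using i by (auto intro: Y_measurable)
  show ?thesis
  proof (cases "Suc i < T")
    case True
    have [measurable]: "(\<lambda>x. Y e x (Suc i)) \<in> borel_measurable (RD D)"
      using True by (rule Y_measurable)
    show ?thesis unfolding dchain_def pre_def by measurable
  next
    case False
    then show ?thesis unfolding dchain_def pre_def by simp measurable
  qed
qed

lemma g_measurable [measurable]: "g e \<in> RD D \<rightarrow>\<^sub>M RD D"
  unfolding g_def
proof (intro measurable_restrict)
  fix k assume k: "k \<in> {..<D}"
  have [measurable]: "(\<lambda>x. x k) \<in> borel_measurable (RD D)"
    using k by (rule measurable_component_singleton)
  show "(\<lambda>x. if k < T * n then A * b / n * (dchain (Y e x) (k div n) * e k / (1 + (b * x k)\<^sup>2) + b * x k / 10) else 0)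
      \<in> borel_measurable (RD D)"
  proof (cases "k < T * n")
    case True
    have [measurable]: "(\<lambda>x. dchain (Y e x) (k div n)) \<in> borel_measurable (RD D)"
      using True by (intro dchain_measurable less_mult_imp_div_less)
    show ?thesis by measurable
  qed simp
qed

lemma prog_measurable [measurable]: "prog e \<in> RD D \<rightarrow>\<^sub>M count_space UNIV"
proof -
  have "Measurable.pred (RD D) (\<lambda>x. s \<le> i \<and> i < T \<longrightarrow> Y e x i \<le> 1/4)" for s i
  proof (cases "s \<le> i \<and> i < T")
    case True
    then have "(\<lambda>x. Y e x i) \<in> borel_measurable (RD D)" by (intro Y_measurable) simp
    then have "Measurable.pred (RD D) (\<lambda>x. Y e x i \<le> 1/4)" by measurable
    moreover have "(\<lambda>x. s \<le> i \<and> i < T \<longrightarrow> Y e x i \<le> 1/4) = (\<lambda>x. Y e x i \<le> 1/4)" using True by blast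
    ultimately show ?thesis by (simp only:)
  next
    case False
    then have "(\<lambda>x. s \<le> i \<and> i < T \<longrightarrow> Y e x i \<le> 1/4) = (\<lambda>_. True)" by blast
    then show ?thesis by (simp only: measurable_const space_count_space UNIV_I)
  qed
  then show ?thesis
    unfolding prog_def by (intro measurable_Least pred_intros_countable(1))
qed

lemma G_measurable [measurable]: "G p e \<in> RD D \<Otimes>\<^sub>M noise p \<rightarrow>\<^sub>M RD D"
  unfolding G_def split_beta'
proof (intro measurable_restrict)
  fix k assume k: "k \<in> {..<D}"
  have c: "(\<lambda>x. x k) \<in> borel_measurable (RD D)"
    using k by (rule measurable_component_singleton)
  have [measurable]: "(\<lambda>x. g e x k) \<in> borel_measurable (RD D)" for e
    using measurable_compose[OF g_measurable c] .
  \<comment> \<open>The truncation point depends on \<open>x\<close> but takes countably many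
    values.\<close>
  have [measurable]: "(\<lambda>x. g (trunc (prog e x) e) x k) \<in> borel_measurable (RD D)"
    by (rule measurable_compose_countable[where g="prog e"]) measurable
  show "(\<lambda>a. g (trunc (prog e (fst a)) e) (fst a) k +
      (if snd a = 1 then (g e (fst a) k - g (trunc (prog e (fst a)) e) (fst a) k) / p else 0))
      \<in> borel_measurable (RD D \<Otimes>\<^sub>M noise p)"
    by measurable
qed

text \<open>The deviation is \<open>(1 - p) / p\<close> times the hidden part with probability
  \<open>p\<close> and the hidden part otherwise, so the variance is its squared norm times
  \<open>(1 - p) / p\<close>. It vanishes for \<open>p = 1\<close>, which makes the noiseless chain
  admissible for every \<open>\<sigma>\<close>.\<close>

lemma G_oracle:
  assumes e: "\<And>k. \<bar>e k\<bar> \<le> 1" and p: "0 < p" "p \<le> 1"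
    and \<sigma>: "p = 1 \<or> 8712 * (A * b)\<^sup>2 / n \<le> p * \<sigma>\<^sup>2"
  shows "stoch_grad_oracle D (F e) \<sigma> (noise p) (G p e)"
  unfolding stoch_grad_oracle_def
proof (intro conjI ballI allI impI prob_space_noise G_measurable)
  fix x assume x: "x \<in> space (RD D)"
  define t where "t = g (trunc (prog e x) e) x"
  have G: "G p e (x, of_bool z) k = t k + (if z then (g e x k - t k) / p else 0)" if "k < D" for k z
    using that by (simp add: G_def t_def)
  show "integrable (noise p) (\<lambda>z. G p e (x, z) k)" if "k < D" for k
    unfolding noise_def by (intro integrable_measure_pmf_finite) simp
  show "(\<integral>z. G p e (x, z) k \<partial>noise p) = grad D (F e) x k" if "k < D" for k
    unfolding noise_def grad_F[OF e x] integral_map_pmf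
    using p that G[OF that, of True] G[OF that, of False]
    by (subst integral_bernoulli_pmf) (auto simp: field_simps)
  define s where "s = (\<Sum>k<D. (g e x k - t k)\<^sup>2)"
  have s: "0 \<le> s" "s \<le> 8712 * (A * b)\<^sup>2 / n"
    using grad_truncation_error[OF e, where x=x] by (auto simp: s_def t_def intro: sum_nonneg)
  have d: "(dist_RD D (G p e (x, of_bool z)) (g e x))\<^sup>2 = (if z then ((1 - p) / p)\<^sup>2 * s else s)" for z
  proof -
    have "(t k + (g e x k - t k) / p - g e x k)\<^sup>2 = ((1 - p) / p)\<^sup>2 * (g e x k - t k)\<^sup>2" for k
    proof -
      have "t k + (g e x k - t k) / p - g e x k = (1 - p) / p * (g e x k - t k)"
        using p by (simp add: field_simps)
      then show ?thesis by (simp only: power_mult_distrib)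
    qed
    then show ?thesis
      unfolding norm_RD_sq s_def by (simp add: G sum_distrib_left power2_commute)
  qed
  have "(\<integral>\<^sup>+z. ennreal ((dist_RD D (G p e (x, z)) (grad D (F e) x))\<^sup>2) \<partial>noise p)
      = ennreal (((1 - p) / p)\<^sup>2 * s) * p + ennreal s * (1 - p)"
    unfolding noise_def grad_F[OF e x] nn_integral_map_pmf d
    using p by (subst nn_integral_bernoulli_pmf) auto
  also have "\<dots> = ennreal (((1 - p) / p)\<^sup>2 * s * p + s * (1 - p))"
    using p s by (simp add: ennreal_mult ennreal_plus)
  also have "((1 - p) / p)\<^sup>2 * s * p + s * (1 - p) = s * ((1 - p) / p)"
    using p by (simp add: power2_eq_square field_simps)
  also have "\<dots> \<le> \<sigma>\<^sup>2"
    using \<sigma>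
  proof
    assume "8712 * (A * b)\<^sup>2 / n \<le> p * \<sigma>\<^sup>2"
    then have "s * (1 - p) \<le> (p * \<sigma>\<^sup>2) * 1" using s p by (intro mult_mono) auto
    then show ?thesis using p by (simp add: field_simps)
  qed simp
  finally show "(\<integral>\<^sup>+z. ennreal ((dist_RD D (G p e (x, z)) (grad D (F e) x))\<^sup>2) \<partial>noise p) \<le> ennreal (\<sigma>\<^sup>2)"
    by (simp add: ennreal_leI)
qed

end

subsection \<open>Runs against hidden signs\<close>

lemma exp_sign_sum:
  fixes x :: real
  assumes "\<bar>x\<bar> \<le> 1"
  shows "exp x + exp (- x) \<le> 2 * exp (x\<^sup>2)"
proof -
  \<comment> \<open>Uses \<open>exp x \<le> 1 + x + x\<^sup>2\<close> and
    \<open>exp (- x) \<le> 1 / (1 + x) \<le> 1 - x + x\<^sup>2\<close>, the latter because the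
    product of \<open>1 - x + x\<^sup>2\<close> and \<open>1 + x\<close> is
    \<open>1 + x ^ 3\<close>.\<close>
  have *: "exp x + exp (- x) \<le> 2 * (1 + x\<^sup>2)" if "0 \<le> x" "x \<le> 1" for x :: real
  proof -
    have "exp (- x) \<le> 1 / (1 + x)"
      using exp_ge_add_one_self[of x] that by (simp add: exp_minus divide_simps)
    also have "\<dots> \<le> 1 - x + x\<^sup>2"
    proof -
      have "1 \<le> (1 - x + x\<^sup>2) * (1 + x)"
        using that by (simp add: algebra_simps power2_eq_square)
      then show ?thesis using that by (simp add: divide_le_eq)
    qed
    finally show ?thesis using exp_bound[OF that] by simp
  qed
  have "exp x + exp (- x) \<le> 2 * (1 + x\<^sup>2)"
    using *[of x] *[of "- x"] assms by (cases "0 \<le> x") auto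
  also have "\<dots> \<le> 2 * exp (x\<^sup>2)" by (intro mult_left_mono exp_ge_add_one_self) auto
  finally show ?thesis .
qed

text \<open>The parameter 1/32 minimises \<open>4 * l\<^sup>2 - l / 4\<close>, the exponent per
  coordinate for coefficients at most 2 and threshold 1/4; the minimum is -1/256.\<close>

lemma sign_sum_mgf:
  fixes c :: "'a \<Rightarrow> real"
  assumes B: "finite B" and c: "\<And>k. k \<in> B \<Longrightarrow> \<bar>c k\<bar> \<le> 2"
  shows "(\<Sum>r\<in>B \<rightarrow>\<^sub>E {-1, 1}. exp ((\<Sum>k\<in>B. r k * c k) / 32)) \<le> 2 ^ card B * exp (card B / 256)"
proof -
  have "(\<Sum>r\<in>B \<rightarrow>\<^sub>E {-1, 1}. exp ((\<Sum>k\<in>B. r k * c k) / 32))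
      = (\<Sum>r\<in>B \<rightarrow>\<^sub>E {-1, 1}. \<Prod>k\<in>B. exp (r k * c k / 32))"
    using B by (simp add: sum_divide_distrib exp_sum)
  also have "\<dots> = (\<Prod>k\<in>B. \<Sum>s\<in>{-1, 1}. exp (s * c k / 32))"
    using B by (intro prod_sum_PiE[symmetric]) auto
  also have "\<dots> \<le> (\<Prod>k\<in>B. 2 * exp (1 / 256))"
  proof (intro prod_mono conjI sum_nonneg)
    fix k assume k: "k \<in> B"
    have "(\<Sum>s\<in>{-1, 1}. exp (s * c k / 32)) = exp (c k / 32) + exp (- (c k / 32))" by simp
    also have "\<dots> \<le> 2 * exp ((c k / 32)\<^sup>2)" using c[OF k] by (intro exp_sign_sum) simp
    also have "(c k / 32)\<^sup>2 \<le> 1 / 256"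
      using power_mono[OF c[OF k], of 2] by (simp add: power_divide)
    finally show "(\<Sum>s\<in>{-1, 1}. exp (s * c k / 32)) \<le> 2 * exp (1 / 256)" by simp
  qed auto
  also have "\<dots> = 2 ^ card B * exp (card B / 256)"
    by (simp add: power_mult_distrib flip: exp_of_nat_mult)
  finally show ?thesis .
qed

text \<open>A maximum and not a sum: machines do not communicate within a round, so all start from
  the same known blocks and what they reveal overlaps.\<close>

definition round_progress :: "nat \<Rightarrow> nat \<Rightarrow> (idx \<Rightarrow> bool) \<Rightarrow> nat \<Rightarrow> nat" where
  "round_progress M K c r = Max ((\<lambda>m. card {k. k < K \<and> c (m, k, r)}) ` {..<M})"

text \<open>
  \<open>level M K c j\<close> bounds the number of blocks known to the query \<open>j\<close>, when \<open>c\<close> marks the queries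
  that reveal a block. It does not depend on the algorithm.
\<close>

definition level :: "nat \<Rightarrow> nat \<Rightarrow> (idx \<Rightarrow> bool) \<Rightarrow> idx \<Rightarrow> nat" where
  "level M K c = (\<lambda>(m, k, r). (\<Sum>r'<r. round_progress M K c r') + card {k'. k' < k \<and> c (m, k', r)})"

lemma card_less_Suc: "card {k'. k' < Suc k \<and> P k'} = card {k'. k' < k \<and> P k'} + of_bool (P k)"
proof -
  have "{k'. k' < Suc k \<and> P k'} = {k'. k' < k \<and> P k'} \<union> (if P k then {k} else {})"
    by (auto simp: less_Suc_eq)
  then show ?thesis by simp
qed

lemma card_less_mono: "(k::nat) \<le> l \<Longrightarrow> card {k'. k' < k \<and> P k'} \<le> card {k'. k' < l \<and> P k'}"
  by (intro card_mono) auto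

lemma card_le_round_progress: "m < M \<Longrightarrow> card {k. k < K \<and> c (m, k, r)} \<le> round_progress M K c r"
  unfolding round_progress_def by (intro Max_ge) auto

lemma level_total:
  assumes "(m, k, r) \<in> ic_indices M K R" "r < R'"
  shows "level M K c (m, k, r) + of_bool (c (m, k, r)) \<le> (\<Sum>r'<R'. round_progress M K c r')"
proof -
  have "level M K c (m, k, r) + of_bool (c (m, k, r))
      = (\<Sum>r'<r. round_progress M K c r') + card {k'. k' < Suc k \<and> c (m, k', r)}"
    by (simp add: level_def card_less_Suc)
  also have "\<dots> \<le> (\<Sum>r'<r. round_progress M K c r') + round_progress M K c r"
    using assms(1) card_less_mono[of "Suc k" K "\<lambda>k. c (m, k, r)"] card_le_round_progress[of m M K c r]
    by (auto simp: ic_indices_def)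
  also have "\<dots> = (\<Sum>r'<Suc r. round_progress M K c r')" by simp
  also have "\<dots> \<le> (\<Sum>r'<R'. round_progress M K c r')" using assms(2) by (intro sum_mono2) auto
  finally show ?thesis .
qed

text \<open>A success at \<open>j'\<close> reveals the block with index
  \<open>level M K c j'\<close>, so this block must count as known at \<open>j\<close>; hence the
  extra unit.\<close>

lemma level_visible:
  assumes j: "j \<in> ic_indices M K R" and j': "j' \<in> ic_visible M K j"
  shows "level M K c j' + of_bool (c j') \<le> level M K c j"
proof -
  obtain m k r where [simp]: "j = (m, k, r)" by (cases j)
  obtain m' k' r' where [simp]: "j' = (m', k', r')" by (cases j')
  consider "m' = m" "k' < k" "r' = r" | "m' < M" "k' < K" "r' < r"
    using j' by (auto simp: ic_visible_def)
  then show ?thesis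
  proof cases
    case 1
    then show ?thesis
      using card_less_mono[of "Suc k'" k "\<lambda>k. c (m, k, r)"] card_less_Suc[of k' "\<lambda>k. c (m, k, r)"]
      by (simp add: level_def)
  next
    case 2
    then have "j' \<in> ic_indices M K R" using j by (auto simp: ic_indices_def)
    then show ?thesis using level_total[of m' k' r' M K R r c] 2 by (simp add: level_def)
  qed
qed

context sign_chain
begin

lemma finite_signs [simp]: "finite signs"
  unfolding signs_def by (intro finite_PiE_dflt) auto

lemma card_signs: "card signs = 2 ^ (T * n)"
  unfolding signs_def by (subst card_PiE_dflt) (auto simp: numeral_2_eq_2)

text \<open>
  Multiplying the signs of one block by further signs permutes \<open>signs\<close>, so the sum over \<open>signs\<close>
  can be averaged over the signs \<open>r\<close> of that block.
\<close>

lemma card_signs_correlated: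
  assumes i: "i < T" and X: "\<And>e e'. (\<And>k. k < T * n \<Longrightarrow> k \<notin> block i \<Longrightarrow> e k = e' k) \<Longrightarrow> X e = X e'"
  shows "real (card {e \<in> signs. Y e (X e) i > 1/4}) \<le> card signs * exp (- real n / 256)"
proof -
  define \<phi> where "\<phi> e = exp ((\<Sum>k\<in>block i. e k * arctan (b * X e k)) / 32)" for e
  define flip where "flip r e = (\<lambda>k. if k \<in> block i then r k * e k else e k)" for r e :: rvec
  let ?R = "block i \<rightarrow>\<^sub>E {-1, 1::real}"
  have flip: "(\<Sum>e\<in>signs. \<phi> e) = (\<Sum>e\<in>signs. \<phi> (flip r e))" if r: "r \<in> ?R" for r
  proof (rule sum.reindex_bij_witness[of _ "flip r" "flip r"])
    have r1: "r k = 1 \<or> r k = -1" if "k \<in> block i" for k using r that by (auto simp: PiE_iff)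
    show "flip r (flip r e) = e" for e
    proof
      fix k
      show "flip r (flip r e) k = e k" using r1[of k] by (auto simp: flip_def)
    qed
    then show "flip r (flip r e) = e" "\<phi> (flip r (flip r e)) = \<phi> e" for e by simp_all
    show "flip r e \<in> signs" if "e \<in> signs" for e
      unfolding signs_def PiE_dflt_def
    proof (intro CollectI allI conjI impI)
      fix k
      show "flip r e k \<in> {-1, 1}" if "k \<in> {..<T * n}"
        using that r1[of k] signsD[OF \<open>e \<in> signs\<close>, of k] by (auto simp: flip_def)
      show "flip r e k = 0" if "k \<notin> {..<T * n}"
        using that block_less[OF i] \<open>e \<in> signs\<close> by (auto simp: flip_def signs_def PiE_dflt_def)
    qed
    then show "flip r e \<in> signs" if "e \<in> signs" for e using that .
  qed
  have "2 ^ n * (\<Sum>e\<in>signs. \<phi> e) = (\<Sum>r\<in>?R. \<Sum>e\<in>signs. \<phi> e)"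
    by (simp add: card_PiE)
  also have "\<dots> = (\<Sum>r\<in>?R. \<Sum>e\<in>signs. \<phi> (flip r e))" by (intro sum.cong refl flip)
  also have "\<dots> = (\<Sum>e\<in>signs. \<Sum>r\<in>?R. \<phi> (flip r e))" by (rule sum.swap)
  also have "\<dots> \<le> (\<Sum>e\<in>signs. 2 ^ n * exp (n / 256))"
  proof (intro sum_mono)
    fix e assume e: "e \<in> signs"
    have "\<phi> (flip r e) = exp ((\<Sum>k\<in>block i. r k * (e k * arctan (b * X e k))) / 32)" for r
    proof -
      \<comment> \<open>The query ignores the signs of block \<open>i\<close>, so flipping leaves it
        fixed and the exponent is linear in \<open>r\<close>.\<close>
      have "X (flip r e) = X e" by (rule X) (simp add: flip_def)
      then show ?thesis by (simp add: \<phi>_def flip_def mult.assoc cong: sum.cong)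
    qed
    moreover have "\<bar>e k * arctan (b * X e k)\<bar> \<le> 2" for k
      using mult_mono[OF signs_abs_le[OF e, of k] arctan_abs_le[of "b * X e k"]] by (simp add: abs_mult)
    ultimately show "(\<Sum>r\<in>?R. \<phi> (flip r e)) \<le> 2 ^ n * exp (n / 256)"
      using sign_sum_mgf[of "block i" "\<lambda>k. e k * arctan (b * X e k)"] by simp
  qed
  also have "\<dots> = 2 ^ n * (card signs * exp (n / 256))" by simp
  finally have \<phi>: "(\<Sum>e\<in>signs. \<phi> e) \<le> card signs * exp (n / 256)" by simp
  \<comment> \<open>Markov's inequality: \<open>Y > 1/4\<close> makes the block sum exceed
    \<open>n / 4\<close>, and dividing by 32 gives \<open>n / 128\<close>.\<close>
  have "card {e \<in> signs. Y e (X e) i > 1/4} * exp (n / 128) = (\<Sum>e\<in>{e \<in> signs. Y e (X e) i > 1/4}. exp (n / 128))"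
    by simp
  also have "\<dots> \<le> (\<Sum>e\<in>{e \<in> signs. Y e (X e) i > 1/4}. \<phi> e)"
  proof (intro sum_mono)
    fix e assume "e \<in> {e \<in> signs. Y e (X e) i > 1/4}"
    then show "exp (n / 128) \<le> \<phi> e"
      using n_pos by (simp add: \<phi>_def Y_def field_simps)
  qed
  also have "\<dots> \<le> (\<Sum>e\<in>signs. \<phi> e)" by (intro sum_mono2) (auto simp: \<phi>_def)
  finally have "card {e \<in> signs. Y e (X e) i > 1/4} * exp (n / 128) \<le> card signs * exp (n / 256)"
    using \<phi> by linarith
  then have "card {e \<in> signs. Y e (X e) i > 1/4} * exp (n / 128) * exp (- real n / 128)
      \<le> card signs * exp (n / 256) * exp (- real n / 128)"
    by (intro mult_right_mono) auto
  then show ?thesis by (simp add: mult.assoc flip: exp_add)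
qed

lemma trunc_cong:
  assumes "s \<le> i" "i < T" "\<And>k. k < T * n \<Longrightarrow> k \<notin> block i \<Longrightarrow> e k = e' k"
  shows "trunc s e = trunc s e'"
proof
  fix k
  show "trunc s e k = trunc s e' k"
  proof (cases "k < s * n")
    case True
    have ki: "k < i * n" using True mult_le_mono1[OF assms(1)] by (rule less_le_trans)
    moreover have "k < T * n"
      using ki mult_le_mono1[of i T n] assms(2) by (meson less_imp_le less_le_trans)
    ultimately have "k < T * n" "k \<notin> block i" by (auto simp: block_def)
    then show ?thesis using assms(3) by (simp add: trunc_def)
  qed (simp add: trunc_def)
qed

end

text \<open>With seed \<open>w\<close> and noise \<open>z\<close> fixed, a run is a deterministic
  function of the signs, so probabilities become counts over \<open>signs\<close>.\<close>

locale chain_run = sign_chain +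
  fixes M K R :: nat and query :: "idx \<Rightarrow> real \<times> history \<Rightarrow> rvec" and out :: "real \<times> history \<Rightarrow> rvec"
    and p w :: real and z :: "idx \<Rightarrow> real"
begin

abbreviation transcript :: "rvec \<Rightarrow> idx \<Rightarrow> rvec \<times> rvec" where
  "transcript e \<equiv> ic_transcript M K query (G p e) w z"

abbreviation lev :: "idx \<Rightarrow> nat" where
  "lev \<equiv> level M K (\<lambda>j. z j = 1)"

definition total :: nat where
  "total = (\<Sum>r<R. round_progress M K (\<lambda>j. z j = 1) r)"

text \<open>The query is taken from the run against truncated signs, not from the real run. It is
  thus independent of the later signs by construction, which makes the failure event countable
  without circularity.\<close>

definition good :: "rvec \<Rightarrow> bool" where
  "good e \<longleftrightarrow> (\<forall>j\<in>ic_indices M K R. prog e (fst (transcript (trunc (lev j) e) j)) \<le> lev j)"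

text \<open>Erased blocks have variable 0, and for a surviving block \<open>i\<close> with
  \<open>lev j \<le> i\<close> the outer truncation at \<open>s\<close> does not affect the query.
  Needed because the comparison of two runs uses the induction hypothesis for \<open>e\<close> and
  for its truncation.\<close>

lemma good_trunc:
  assumes "good e" shows "good (trunc s e)"
  unfolding good_def
proof
  fix j assume j: "j \<in> ic_indices M K R"
  let ?x = "fst (transcript (trunc (min (lev j) s) e) j)"
  have "prog (trunc s e) ?x \<le> lev j"
  proof (rule prog_le)
    fix i assume i: "lev j \<le> i" "i < T"
    show "Y (trunc s e) ?x i \<le> 1/4"
    proof (cases "i < s")
      case True
      then have "min (lev j) s = lev j" using i by simp
      then have "prog e ?x \<le> i" using assms j i(1) by (fastforce simp: good_def)
      then show ?thesis using Y_prog[of e ?x i] i(2) True by (simp add: Y_trunc)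
    qed (simp add: Y_trunc)
  qed
  then show "prog (trunc s e) (fst (transcript (trunc (lev j) (trunc s e)) j)) \<le> lev j"
    by (simp add: trunc_trunc)
qed

text \<open>If the query of every good run uses only \<open>lev j\<close> blocks, then its answer
  uses at most one more, and that one only on a success.\<close>

lemma transcript_trunc_answer:
  assumes e: "good e" and j: "j \<in> ic_indices M K R" and L: "lev j + of_bool (z j = 1) \<le> L"
    and q: "\<And>e. good e \<Longrightarrow> fst (transcript e j) = fst (transcript (trunc (lev j) e) j)"
  shows "transcript (trunc L e) j = transcript e j"
proof -
  have f: "fst (transcript (trunc L e) j) = fst (transcript e j)"
    using q[OF e] q[OF good_trunc[OF e, of L]] L by (simp add: trunc_trunc min_absorb1)
  have t: "transcript e' j = (fst (transcript e' j), G p e' (fst (transcript e' j), z j))" for e'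
    by (subst (1 2 3) ic_transcript.simps) (simp add: Let_def)
  have "prog e (fst (transcript e j)) \<le> lev j"
    unfolding q[OF e] using e j by (auto simp: good_def)
  then have "G p (trunc L e) (fst (transcript e j), z j) = G p e (fst (transcript e j), z j)"
    using L by (intro G_trunc) auto
  then show ?thesis by (subst (1 2) t) (simp add: f)
qed

text \<open>Induction along visibility: by \<open>level_visible\<close> each visible answer survives
  truncation at \<open>lev j\<close>, so the query is computed from the same history.\<close>

lemma query_trunc:
  "j \<in> ic_indices M K R \<Longrightarrow> good e \<Longrightarrow> fst (transcript e j) = fst (transcript (trunc (lev j) e) j)"
proof (induction j arbitrary: e rule: ic_visible_induct[of M K])
  case (visible j)
  have "transcript (trunc (lev j) e) j' = transcript e j'" if j': "j' \<in> ic_visible M K j" for j'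
  proof (rule transcript_trunc_answer)
    show "j' \<in> ic_indices M K R" using j' visible.prems(1) ic_visible_subset by blast
    then show "fst (transcript e j') = fst (transcript (trunc (lev j') e) j')" if "good e" for e
      using visible.IH[OF j'] that by blast
    show "lev j' + of_bool (z j' = 1) \<le> lev j"
      using level_visible[OF visible.prems(1) j', of "\<lambda>j. z j = 1"] .
  qed (use visible.prems in simp)
  then have "(\<lambda>j'\<in>ic_visible M K j. transcript (trunc (lev j) e) j') = (\<lambda>j'\<in>ic_visible M K j. transcript e j')"
    by (intro restrict_ext) auto
  then show ?case by (subst (1 2) ic_transcript.simps) (simp add: Let_def)
qed

abbreviation result :: "rvec \<Rightarrow> rvec" where
  "result e \<equiv> ic_output M K R query out (G p e) w z"

lemma output_trunc:
  assumes e: "good e"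
  shows "result (trunc total e) = result e"
proof -
  have "transcript (trunc total e) j = transcript e j" if j: "j \<in> ic_indices M K R" for j
  proof (rule transcript_trunc_answer[OF e j])
    obtain m k r where [simp]: "j = (m, k, r)" by (cases j)
    show "lev j + of_bool (z j = 1) \<le> total"
      using level_total[of m k r M K R R "\<lambda>j. z j = 1"] j by (auto simp: total_def ic_indices_def)
  qed (use query_trunc[OF j] in blast)
  then have "(\<lambda>j\<in>ic_indices M K R. transcript (trunc total e) j) = (\<lambda>j\<in>ic_indices M K R. transcript e j)"
    by (intro restrict_ext) auto
  then show ?thesis unfolding ic_output_def by simp
qed

text \<open>Union bound over the erased blocks; \<open>X\<close> stands for any query or for the
  output, seen as a function of the truncated signs.\<close>

lemma card_not_prog_le:
  "real (card {e \<in> signs. \<not> prog e (X (trunc s e)) \<le> s}) \<le> T * (card signs * exp (- real n / 256))"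
proof -
  define B where "B i = {e \<in> signs. Y e (X (trunc s e)) i > 1/4}" for i
  have "{e \<in> signs. \<not> prog e (X (trunc s e)) \<le> s} \<subseteq> (\<Union>i\<in>{s..<T}. B i)"
  proof
    fix e assume e: "e \<in> {e \<in> signs. \<not> prog e (X (trunc s e)) \<le> s}"
    then obtain i where "s \<le> i" "i < T" "\<not> Y e (X (trunc s e)) i \<le> 1/4"
      using prog_le[of s e "X (trunc s e)"] by blast
    then have "i \<in> {s..<T}" "e \<in> B i" using e by (auto simp: B_def)
    then show "e \<in> (\<Union>i\<in>{s..<T}. B i)" by blast
  qed
  then have "card {e \<in> signs. \<not> prog e (X (trunc s e)) \<le> s} \<le> card (\<Union>i\<in>{s..<T}. B i)"
    by (intro card_mono) (auto simp: B_def)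
  also have "\<dots> \<le> (\<Sum>i\<in>{s..<T}. card (B i))" by (intro card_UN_le) auto
  finally have "real (card {e \<in> signs. \<not> prog e (X (trunc s e)) \<le> s}) \<le> (\<Sum>i\<in>{s..<T}. real (card (B i)))"
    unfolding of_nat_sum[symmetric] of_nat_le_iff .
  also have "\<dots> \<le> (\<Sum>i\<in>{s..<T}. card signs * exp (- real n / 256))"
  proof (intro sum_mono)
    fix i assume i: "i \<in> {s..<T}"
    show "real (card (B i)) \<le> card signs * exp (- real n / 256)"
      unfolding B_def
    proof (rule card_signs_correlated)
      show "X (trunc s e) = X (trunc s e')" if "\<And>k. k < T * n \<Longrightarrow> k \<notin> block i \<Longrightarrow> e k = e' k" for e e'
        using trunc_cong[of s i e e'] that i by simp
    qed (use i in simp)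
  qed
  also have "\<dots> \<le> T * (card signs * exp (- real n / 256))"
    by (simp add: mult_right_mono)
  finally show ?thesis .
qed

text \<open>The bad events are one for each of the \<open>M * (K * R)\<close> queries and one for
  the output. Outside them block \<open>T - 1\<close> is still undiscovered at the output, so the
  gradient is large.\<close>

lemma card_large_gradient:
  assumes tot: "total < T" and n: "(M * (K * R) + 1) * T * exp (- real n / 256) \<le> 1/4"
  shows "3/4 * card signs \<le> card {e \<in> signs. A * b / sqrt n / 34 \<le> norm_RD D (g e (result e))}"
proof -
  let ?I = "ic_indices M K R"
  define U where "U j = {e \<in> signs. \<not> prog e (fst (transcript (trunc (lev j) e) j)) \<le> lev j}" for j
  define V where "V = {e \<in> signs. \<not> prog e (result (trunc total e)) \<le> total}"
  define W where "W = {e \<in> signs. A * b / sqrt n / 34 \<le> norm_RD D (g e (result e))}"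
  define c where "c = T * (card signs * exp (- real n / 256))"
  have "signs - ((\<Union>j\<in>?I. U j) \<union> V) \<subseteq> W"
  proof
    fix e assume e: "e \<in> signs - ((\<Union>j\<in>?I. U j) \<union> V)"
    then have "good e" "prog e (result (trunc total e)) \<le> total" by (auto simp: good_def U_def V_def)
    then have "prog e (result e) \<le> total" by (simp add: output_trunc)
    then have "Y e (result e) (T - 1) \<le> 1/4" using tot by (intro Y_prog) auto
    then show "e \<in> W" using e grad_lower_bound[of e "result e"] by (auto simp: W_def)
  qed
  then have "card (signs - ((\<Union>j\<in>?I. U j) \<union> V)) \<le> card W"
    by (intro card_mono) (auto simp: W_def)
  moreover have "card signs - card ((\<Union>j\<in>?I. U j) \<union> V) \<le> card (signs - ((\<Union>j\<in>?I. U j) \<union> V))"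
    by (intro diff_card_le_card_Diff) (auto simp: U_def V_def)
  moreover have "card ((\<Union>j\<in>?I. U j) \<union> V) \<le> (\<Sum>j\<in>?I. card (U j)) + card V"
    by (intro order_trans[OF card_Un_le] add_mono card_UN_le) auto
  ultimately have "real (card signs) \<le> card W + ((\<Sum>j\<in>?I. real (card (U j))) + card V)"
    unfolding of_nat_sum[symmetric] by linarith
  also have "(\<Sum>j\<in>?I. real (card (U j))) + card V \<le> (\<Sum>j\<in>?I. c) + c"
    unfolding U_def V_def c_def by (intro add_mono sum_mono card_not_prog_le)
  also have "\<dots> = card signs * ((M * (K * R) + 1) * T * exp (- real n / 256))"
    by (simp add: c_def card_ic_indices algebra_simps)
  also have "\<dots> \<le> card signs * (1/4)" using n by (intro mult_left_mono) auto
  finally show ?thesis by (simp add: W_def)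
qed

end

subsection \<open>Averaging over the signs and tails of the progress\<close>

text \<open>The best machine of a round is random. Fixing a machine for every round gives a
  deterministic index set, for which tails can be computed.\<close>

definition machine_path :: "nat \<Rightarrow> nat \<Rightarrow> (nat \<Rightarrow> nat) \<Rightarrow> idx set" where
  "machine_path K R \<mu> = (\<lambda>(r, k). (\<mu> r, k, r)) ` ({..<R} \<times> {..<K})"

lemma inj_machine_path: "inj_on (\<lambda>(r, k). (\<mu> r, k, r)) A"
  by (auto simp: inj_on_def)

lemma card_machine_path: "card (machine_path K R \<mu>) = R * K"
  unfolding machine_path_def by (subst card_image[OF inj_machine_path]) simp

lemma machine_path_subset: "\<mu> \<in> {..<R} \<rightarrow>\<^sub>E {..<M} \<Longrightarrow> machine_path K R \<mu> \<subseteq> ic_indices M K R"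
  by (auto simp: machine_path_def ic_indices_def)

text \<open>A best machine in each round: the total progress counts the successes along one path.\<close>

lemma total_progress_path:
  assumes "M \<ge> 1"
  obtains \<mu> where "\<mu> \<in> {..<R} \<rightarrow>\<^sub>E {..<M}"
    "(\<Sum>r<R. round_progress M K c r) = card {j \<in> machine_path K R \<mu>. c j}"
proof -
  have "\<exists>m<M. round_progress M K c r = card {k. k < K \<and> c (m, k, r)}" for r
  proof -
    have "round_progress M K c r \<in> (\<lambda>m. card {k. k < K \<and> c (m, k, r)}) ` {..<M}"
      unfolding round_progress_def using assms by (intro Max_in) (auto simp: lessThan_empty_iff)
    then show ?thesis by auto
  qed
  then obtain m where m: "\<And>r. m r < M" "\<And>r. round_progress M K c r = card {k. k < K \<and> c (m r, k, r)}"
    by metis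
  let ?\<mu> = "restrict m {..<R}"
  have "(\<Sum>r<R. round_progress M K c r) = card (SIGMA r:{..<R}. {k. k < K \<and> c (m r, k, r)})"
    unfolding m(2) by (subst card_SigmaI) auto
  also have "\<dots> = card ((\<lambda>(r, k). (m r, k, r)) ` (SIGMA r:{..<R}. {k. k < K \<and> c (m r, k, r)}))"
    by (rule card_image[OF inj_machine_path, symmetric])
  also have "(\<lambda>(r, k). (m r, k, r)) ` (SIGMA r:{..<R}. {k. k < K \<and> c (m r, k, r)}) = {j \<in> machine_path K R ?\<mu>. c j}"
    unfolding machine_path_def by (auto simp: image_iff)
  finally show ?thesis by (intro that[of ?\<mu>]) (use m in auto)
qed

lemma noise_one_measurable: "finite I \<Longrightarrow> j \<in> I \<Longrightarrow> Measurable.pred (Pi\<^sub>M I (\<lambda>_. noise p)) (\<lambda>z. z j = 1)"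
  by (rule measurable_compose[OF measurable_component_singleton]) simp_all

lemma card_noise_measurable:
  assumes "finite I" "J \<subseteq> I"
  shows "(\<lambda>z. real (card {j \<in> J. z j = 1})) \<in> borel_measurable (Pi\<^sub>M I (\<lambda>_. noise p))"
proof -
  have "(\<lambda>z. \<Sum>j\<in>J. if z j = 1 then 1 else 0::real) \<in> borel_measurable (Pi\<^sub>M I (\<lambda>_. noise p))"
    using assms by (intro borel_measurable_sum measurable_If noise_one_measurable) auto
  moreover have "real (card {j \<in> J. z j = 1}) = (\<Sum>j\<in>J. if z j = 1 then 1 else 0)" for z :: "'a \<Rightarrow> real"
    using finite_subset[OF assms(2,1)] by (simp add: sum.If_cases Int_def)
  ultimately show ?thesis by simp
qed

text \<open>Chernoff bound with parameter 1: one factor is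
  \<open>1 + (exp 1 - 1) * p \<le> exp (2 * p)\<close>, and independence multiplies the
  factors.\<close>

lemma noise_tail:
  assumes I: "finite I" "J \<subseteq> I" and p: "0 \<le> p" "p \<le> 1"
  shows "emeasure (Pi\<^sub>M I (\<lambda>_. noise p)) {z \<in> space (Pi\<^sub>M I (\<lambda>_. noise p)). t \<le> real (card {j \<in> J. z j = 1})}
     \<le> ennreal (exp (2 * p * card J - t))"
proof -
  interpret product_sigma_finite "\<lambda>_. noise p"
    by (intro product_sigma_finite.intro prob_space_imp_sigma_finite prob_space_noise)
  let ?N = "Pi\<^sub>M I (\<lambda>_. noise p)"
  have J: "finite J" using I finite_subset by blast
  define h where "h j s = (if j \<in> J \<and> s = (1::real) then exp 1 else 1 :: real)" for j s
  have h1: "(\<integral>\<^sup>+s. ennreal (h j s) \<partial>noise p) \<le> ennreal (if j \<in> J then exp (2 * p) else 1)" for j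
  proof -
    have "(\<integral>\<^sup>+s. ennreal (h j s) \<partial>noise p) = ennreal (h j 1) * p + ennreal (h j 0) * (1 - p)"
      unfolding noise_def nn_integral_map_pmf using p by (subst nn_integral_bernoulli_pmf) auto
    also have "\<dots> = ennreal (h j 1 * p + h j 0 * (1 - p))"
      using p by (simp add: ennreal_mult ennreal_plus h_def)
    also have "h j 1 * p + h j 0 * (1 - p) \<le> (if j \<in> J then exp (2 * p) else 1)"
    proof (cases "j \<in> J")
      case True
      have "h j 1 * p + h j 0 * (1 - p) = 1 + (exp 1 - 1) * p" using True by (simp add: h_def algebra_simps)
      also have "\<dots> \<le> 1 + 2 * p" using p e_less_272 by (intro add_left_mono mult_right_mono) auto
      also have "\<dots> \<le> exp (2 * p)" by (rule exp_ge_add_one_self)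
      finally show ?thesis using True by simp
    qed (simp add: h_def)
    finally show ?thesis by (simp add: ennreal_leI)
  qed
  have prod: "(\<Prod>j\<in>I. ennreal (h j (z j))) = ennreal (exp (card {j \<in> J. z j = 1}))" for z
  proof -
    have "(\<Prod>j\<in>I. h j (z j)) = (\<Prod>j\<in>{j \<in> J. z j = 1}. exp 1)"
      using I by (intro prod.mono_neutral_cong_right) (auto simp: h_def)
    also have "\<dots> = exp (card {j \<in> J. z j = 1})" by (simp flip: exp_of_nat_mult)
    finally show ?thesis by (subst prod_ennreal) (auto simp: h_def)
  qed
  have "(\<integral>\<^sup>+z. ennreal (exp (card {j \<in> J. z j = 1})) \<partial>?N) = (\<Prod>j\<in>I. \<integral>\<^sup>+s. ennreal (h j s) \<partial>noise p)"
    unfolding prod[symmetric] by (rule product_nn_integral_prod[OF I(1)]) simp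
  also have "\<dots> \<le> (\<Prod>j\<in>I. ennreal (if j \<in> J then exp (2 * p) else 1))"
    by (intro prod_mono_ennreal h1)
  also have "\<dots> = ennreal (exp (2 * p * card J))"
  proof -
    have "(\<Prod>j\<in>I. if j \<in> J then exp (2 * p) else 1) = (\<Prod>j\<in>J. exp (2 * p))"
      using I by (intro prod.mono_neutral_cong_right) auto
    then show ?thesis by (subst prod_ennreal) (auto simp: mult_ac simp flip: exp_of_nat_mult)
  qed
  finally have mgf: "(\<integral>\<^sup>+z. ennreal (exp (card {j \<in> J. z j = 1})) \<partial>?N) \<le> ennreal (exp (2 * p * card J))" .
  have "emeasure ?N {z \<in> space ?N. t \<le> real (card {j \<in> J. z j = 1})}
      = (\<integral>\<^sup>+z. indicator {z \<in> space ?N. t \<le> real (card {j \<in> J. z j = 1})} z \<partial>?N)"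
    using card_noise_measurable[OF I] by (intro nn_integral_indicator[symmetric]) simp
  also have "\<dots> \<le> (\<integral>\<^sup>+z. ennreal (exp (- t)) * ennreal (exp (card {j \<in> J. z j = 1})) \<partial>?N)"
  proof (intro nn_integral_mono)
    fix z
    show "indicator {z \<in> space ?N. t \<le> real (card {j \<in> J. z j = 1})} z
        \<le> ennreal (exp (- t)) * ennreal (exp (card {j \<in> J. z j = 1}))"
      by (auto simp: indicator_def simp flip: ennreal_mult exp_add)
  qed
  also have "\<dots> = ennreal (exp (- t)) * (\<integral>\<^sup>+z. ennreal (exp (card {j \<in> J. z j = 1})) \<partial>?N)"
    using card_noise_measurable[OF I] by (intro nn_integral_cmult) simp
  also have "\<dots> \<le> ennreal (exp (- t)) * ennreal (exp (2 * p * card J))"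
    by (intro mult_left_mono mgf) simp
  also have "\<dots> = ennreal (exp (2 * p * card J - t))"
    by (simp flip: ennreal_mult exp_add)
  finally show ?thesis .
qed

text \<open>The largest of finitely many integrals is at least their average.\<close>

lemma exists_nn_integral_ge_average:
  assumes \<Theta>: "finite \<Theta>" "\<Theta> \<noteq> {}" and f: "\<And>\<theta>. \<theta> \<in> \<Theta> \<Longrightarrow> f \<theta> \<in> borel_measurable P"
    and c: "ennreal (real (card \<Theta>) * c) \<le> (\<integral>\<^sup>+a. (\<Sum>\<theta>\<in>\<Theta>. f \<theta> a) \<partial>P)"
  shows "\<exists>\<theta>\<in>\<Theta>. ennreal c \<le> (\<integral>\<^sup>+a. f \<theta> a \<partial>P)"
proof -
  let ?X = "\<lambda>\<theta>. \<integral>\<^sup>+a. f \<theta> a \<partial>P"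
  have "finite (?X ` \<Theta>)" "?X ` \<Theta> \<noteq> {}" using \<Theta> by auto
  from Max_in[OF this] obtain \<theta> where \<theta>: "Max (?X ` \<Theta>) = ?X \<theta>" "\<theta> \<in> \<Theta>" by (rule imageE)
  have "(\<integral>\<^sup>+a. (\<Sum>\<theta>\<in>\<Theta>. f \<theta> a) \<partial>P) = (\<Sum>\<theta>\<in>\<Theta>. ?X \<theta>)"
    using f by (rule nn_integral_sum)
  also have "\<dots> \<le> of_nat (card \<Theta>) * ?X \<theta>"
    unfolding \<theta>(1)[symmetric] using \<Theta> by (intro sum_bounded_above Max_ge) auto
  finally have "ennreal (card \<Theta>) * ennreal c \<le> ennreal (card \<Theta>) * ?X \<theta>"
    using c by (subst (asm) ennreal_mult') (auto simp: ennreal_of_nat_eq_real_of_nat)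
  then have "ennreal c \<le> ?X \<theta>"
    using \<Theta> by (subst (asm) ennreal_mult_le_mult_iff) (auto simp: card_gt_0_iff)
  then show ?thesis using \<theta>(2) by blast
qed

context sign_chain
begin

text \<open>For every seed and every noise in \<open>E\<close> at least 3/4 of the signs are hard,
  and \<open>E\<close> has probability at least 3/4; hence the factor 9/16 after exchanging sum and
  integral.\<close>

lemma exists_hard_signs:
  assumes alg: "ic_algorithm M K R D S query out"
    and n: "(M * (K * R) + 1) * T * exp (- real n / 256) \<le> 1/4"
    and E: "E \<in> sets (Pi\<^sub>M (ic_indices M K R) (\<lambda>_. noise p))"
      "ennreal (3/4) \<le> emeasure (Pi\<^sub>M (ic_indices M K R) (\<lambda>_. noise p)) E"
    and tot: "\<And>z. z \<in> E \<Longrightarrow> (\<Sum>r<R. round_progress M K (\<lambda>j. z j = 1) r) < T"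
  shows "\<exists>e\<in>signs. ennreal (9/16 * (A * b / sqrt n / 34)) \<le>
    expected_grad_norm M K R D S query out (F e) (noise p) (G p e)"
proof -
  let ?N = "Pi\<^sub>M (ic_indices M K R) (\<lambda>_. noise p)"
  let ?P = "S \<Otimes>\<^sub>M ?N"
  define \<gamma> where "\<gamma> = A * b / sqrt n / 34"
  have \<gamma>: "0 \<le> \<gamma>" using A_pos b_pos by (simp add: \<gamma>_def)
  interpret S: prob_space S using alg by (simp add: ic_algorithm_def)
  interpret N: prob_space ?N by (intro prob_space_PiM prob_space_noise)
  define x where "x e a = ic_output M K R query out (G p e) (fst a) (snd a)" for e and a :: "real \<times> (idx \<Rightarrow> real)"
  have x: "x e \<in> ?P \<rightarrow>\<^sub>M RD D" for e
    using ic_output_measurable[OF alg G_measurable] unfolding x_def split_beta' .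
  define f where "f e a = ennreal (norm_RD D (g e (x e a)))" for e a
  have f: "f e \<in> borel_measurable ?P" for e
    unfolding f_def using measurable_compose[OF measurable_compose[OF x g_measurable] norm_RD_measurable]
    by simp
  let ?X = "\<lambda>e. expected_grad_norm M K R D S query out (F e) (noise p) (G p e)"
  have X: "?X e = (\<integral>\<^sup>+a. f e a \<partial>?P)" if "e \<in> signs" for e
    unfolding expected_grad_norm_def
  proof (intro nn_integral_cong)
    fix a assume "a \<in> space ?P"
    then have "x e a \<in> space (RD D)" using x by (rule measurable_space[rotated])
    then show "(case a of (w, z) \<Rightarrow> ennreal (norm_RD D (grad D (F e) (ic_output M K R query out (G p e) w z)))) = f e a"
      unfolding f_def split_beta' x_def by (subst grad_F) (auto simp: signs_abs_le that)
  qed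
  have "ennreal (card signs * (9/16 * \<gamma>)) = ennreal (3/4 * card signs * \<gamma>) * ennreal (3/4)"
    using \<gamma> by (subst ennreal_mult[symmetric]) (auto simp: mult_ac)
  also have "\<dots> \<le> ennreal (3/4 * card signs * \<gamma>) * emeasure ?P (space S \<times> E)"
    using E by (subst N.emeasure_pair_measure_Times) (auto simp: S.emeasure_space_1 intro!: mult_left_mono)
  also have "\<dots> = (\<integral>\<^sup>+a. ennreal (3/4 * card signs * \<gamma>) * indicator (space S \<times> E) a \<partial>?P)"
    using E by (subst nn_integral_cmult_indicator) auto
  also have "\<dots> \<le> (\<integral>\<^sup>+a. (\<Sum>e\<in>signs. f e a) \<partial>?P)"
  proof (intro nn_integral_mono)
    fix a :: "real \<times> (idx \<Rightarrow> real)"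
    show "ennreal (3/4 * card signs * \<gamma>) * indicator (space S \<times> E) a \<le> (\<Sum>e\<in>signs. f e a)"
    proof (cases "a \<in> space S \<times> E")
      case True
      interpret chain_run D n T A b M K R query out p "fst a" "snd a" ..
      define W where "W = {e \<in> signs. \<gamma> \<le> norm_RD D (g e (x e a))}"
      have "3/4 * card signs \<le> card W"
        using card_large_gradient[OF _ n] tot True by (auto simp: total_def W_def x_def \<gamma>_def)
      then have "3/4 * card signs * \<gamma> \<le> card W * \<gamma>" using \<gamma> by (intro mult_right_mono)
      also have "\<dots> = (\<Sum>e\<in>W. \<gamma>)" by simp
      also have "\<dots> \<le> (\<Sum>e\<in>W. norm_RD D (g e (x e a)))" by (intro sum_mono) (simp add: W_def)
      also have "\<dots> \<le> (\<Sum>e\<in>signs. norm_RD D (g e (x e a)))"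
        by (intro sum_mono2) (auto simp: W_def L2_set_nonneg)
      finally show ?thesis
        using True by (simp add: f_def L2_set_nonneg ennreal_leI)
    qed simp
  qed
  finally have le: "ennreal (card signs * (9/16 * \<gamma>)) \<le> (\<integral>\<^sup>+a. (\<Sum>e\<in>signs. f e a) \<partial>?P)" .
  have "signs \<noteq> {}" using card_signs by fastforce
  from exists_nn_integral_ge_average[OF finite_signs this f le]
  have "\<exists>e\<in>signs. ennreal (9/16 * \<gamma>) \<le> (\<integral>\<^sup>+a. f e a \<partial>?P)" .
  then show ?thesis using X unfolding \<gamma>_def by metis
qed

end

section \<open>From slow progress to a forced gradient\<close>

definition forced_gradient ::
  "nat \<Rightarrow> nat \<Rightarrow> nat \<Rightarrow> nat \<Rightarrow> real measure \<Rightarrow> (idx \<Rightarrow> real \<times> history \<Rightarrow> rvec) \<Rightarrow>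
     (real \<times> history \<Rightarrow> rvec) \<Rightarrow> real \<Rightarrow> real \<Rightarrow> real \<Rightarrow> real \<Rightarrow> bool" where
  "forced_gradient M K R D S query out H \<Delta> \<sigma> c \<longleftrightarrow>
     (\<exists>F\<in>nonconvex_class D H \<Delta>. \<exists>Z G. stoch_grad_oracle D F \<sigma> Z G \<and>
        expected_grad_norm M K R D S query out F Z G \<ge> ennreal c)"

lemma forced_gradient_mono:
  "forced_gradient M K R D S query out H \<Delta> \<sigma> c \<Longrightarrow> c' \<le> c \<Longrightarrow>
    forced_gradient M K R D S query out H \<Delta> \<sigma> c'"
  unfolding forced_gradient_def by (meson ennreal_leI order_trans)

text \<open>An inner event \<open>E\<close> stands in for the event itself, so measurability is
  shown for the complements of explicit tail events.\<close>

definition slow_progress :: "nat \<Rightarrow> nat \<Rightarrow> nat \<Rightarrow> real \<Rightarrow> nat \<Rightarrow> bool" where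
  "slow_progress M K R p T \<longleftrightarrow> (\<exists>E\<in>sets (Pi\<^sub>M (ic_indices M K R) (\<lambda>_. noise p)).
     ennreal (3/4) \<le> emeasure (Pi\<^sub>M (ic_indices M K R) (\<lambda>_. noise p)) E \<and>
     (\<forall>z\<in>E. (\<Sum>r<R. round_progress M K (\<lambda>j. z j = 1) r) < T))"

lemma forced_gradient_chain:
  assumes alg: "ic_algorithm M K R D S query out"
    and pos: "H > 0" "\<Delta> > 0" "T > 0" "n > 0" and D: "T * n \<le> D"
    and n: "real ((M * (K * R) + 1) * T) * exp (- real n / 256) \<le> 1/4"
    and p: "0 < p" "p \<le> 1" "p = 1 \<or> H * \<Delta> / T \<le> p * \<sigma>\<^sup>2"
    and slow: "slow_progress M K R p T"
  shows "forced_gradient M K R D S query out H \<Delta> \<sigma> (sqrt (H * \<Delta> / T) / 8000)"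
proof -
  \<comment> \<open>\<open>A\<close> exhausts the initial gap \<open>4 * A * T\<close>, and
    \<open>b\<close> solves the smoothness equation, where 3324 = 6 * 554. Then
    \<open>(A * b)\<^sup>2 / n\<close> equals \<open>H * \<Delta> / T\<close> over 4 * 3324 =
    13296.\<close>
  define A where "A = \<Delta> / (4 * T)"
  define b where "b = sqrt (H * n / (3324 * A))"
  have A: "A > 0" using pos by (simp add: A_def)
  have b: "b > 0" using pos A by (simp add: b_def)
  have b2: "b\<^sup>2 = H * n / (3324 * A)" using pos A by (simp add: b_def)
  interpret sign_chain D n T A b using pos D A b by unfold_locales
  have Ab: "(A * b)\<^sup>2 / n = H * \<Delta> / T / 13296"
    using pos A unfolding power_mult_distrib b2 by (simp add: A_def field_simps power2_eq_square)
  obtain E where E: "E \<in> sets (Pi\<^sub>M (ic_indices M K R) (\<lambda>_. noise p))"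
    "ennreal (3/4) \<le> emeasure (Pi\<^sub>M (ic_indices M K R) (\<lambda>_. noise p)) E"
    "\<And>z. z \<in> E \<Longrightarrow> (\<Sum>r<R. round_progress M K (\<lambda>j. z j = 1) r) < T"
    using slow unfolding slow_progress_def by blast
  obtain e where e: "e \<in> signs" and lb: "ennreal (9/16 * (A * b / sqrt n / 34)) \<le>
    expected_grad_norm M K R D S query out (F e) (noise p) (G p e)"
    using exists_hard_signs[OF alg n E] by blast
  \<comment> \<open>116^2 = 13456 is slightly above 13296; the factor 9/16 / (34 * 116) is above
    1/8000.\<close>
  have grad_size: "sqrt (H * \<Delta> / T) / 116 \<le> A * b / sqrt n"
  proof (rule power2_le_imp_le)
    have "(sqrt (H * \<Delta> / T) / 116)\<^sup>2 = H * \<Delta> / T / 13456" using pos by (simp add: power_divide)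
    also have "\<dots> \<le> H * \<Delta> / T / 13296" using pos by (intro divide_left_mono) auto
    also have "\<dots> = (A * b / sqrt n)\<^sup>2" using Ab by (simp add: power_divide)
    finally show "(sqrt (H * \<Delta> / T) / 116)\<^sup>2 \<le> (A * b / sqrt n)\<^sup>2" .
  qed (use A b in simp)
  have "sqrt (H * \<Delta> / T) / 8000 \<le> 9/16 * (A * b / sqrt n / 34)"
  proof -
    have *: "s / 8000 \<le> 9/16 * (u / 34)" if "s / 116 \<le> u" "0 \<le> s" for s u :: real
      using that by simp
    show ?thesis using grad_size by (rule *) (use pos in simp)
  qed
  then have "ennreal (sqrt (H * \<Delta> / T) / 8000) \<le>
      expected_grad_norm M K R D S query out (F e) (noise p) (G p e)"
    by (intro order_trans[OF ennreal_leI lb])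
  moreover have "F e \<in> nonconvex_class D H \<Delta>"
    using pos A e by (intro F_in_class) (auto simp: b2 A_def)
  moreover have "stoch_grad_oracle D (F e) \<sigma> (noise p) (G p e)"
  proof (rule G_oracle[OF signs_abs_le[OF e] p(1,2)])
    have "0 \<le> H * \<Delta> / T" using pos by simp
    then have "8712 * ((A * b)\<^sup>2 / n) \<le> H * \<Delta> / T" unfolding Ab by argo
    then have "8712 * (A * b)\<^sup>2 / n \<le> H * \<Delta> / T" by simp
    with p(3) show "p = 1 \<or> 8712 * (A * b)\<^sup>2 / n \<le> p * \<sigma>\<^sup>2" by linarith
  qed
  ultimately show ?thesis unfolding forced_gradient_def by blast
qed

text \<open>The total equals the count along some path, so it suffices to control every path outside
  one bad set. The bound \<open>exp (- 2) \<le> 1/4\<close> explains the slack of 2 in the lemmas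
  below.\<close>

lemma slow_progressI:
  assumes M: "M \<ge> 1"
    and B: "B \<in> sets (Pi\<^sub>M (ic_indices M K R) (\<lambda>_. noise p))"
      "emeasure (Pi\<^sub>M (ic_indices M K R) (\<lambda>_. noise p)) B \<le> ennreal (exp (- 2))"
    and path: "\<And>z \<mu>. z \<in> space (Pi\<^sub>M (ic_indices M K R) (\<lambda>_. noise p)) \<Longrightarrow> z \<notin> B \<Longrightarrow>
      \<mu> \<in> {..<R} \<rightarrow>\<^sub>E {..<M} \<Longrightarrow> card {j \<in> machine_path K R \<mu>. z j = 1} < T"
  shows "slow_progress M K R p T"
  unfolding slow_progress_def
proof (intro bexI conjI ballI)
  let ?N = "Pi\<^sub>M (ic_indices M K R) (\<lambda>_. noise p)"
  interpret N: prob_space ?N by (intro prob_space_PiM prob_space_noise)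
  show "space ?N - B \<in> sets ?N" using B by simp
  have "4 \<le> exp (2::real)"
  proof -
    have "2\<^sup>2 \<le> (exp (1::real))\<^sup>2" using exp_ge_add_one_self[of 1] by (intro power_mono) auto
    then show ?thesis by (simp flip: exp_of_nat_mult)
  qed
  then have "exp (- 2) \<le> (1/4 :: real)" by (simp add: exp_minus divide_simps)
  then have "N.prob B \<le> 1/4" using B(2) by (simp add: N.emeasure_eq_measure)
  then show "ennreal (3/4) \<le> emeasure ?N (space ?N - B)"
    using N.prob_compl[OF B(1)] by (simp add: N.emeasure_eq_measure)
  fix z assume z: "z \<in> space ?N - B"
  obtain \<mu> where "\<mu> \<in> {..<R} \<rightarrow>\<^sub>E {..<M}"
    "(\<Sum>r<R. round_progress M K (\<lambda>j. z j = 1) r) = card {j \<in> machine_path K R \<mu>. z j = 1}"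
    by (rule total_progress_path[OF M])
  then show "(\<Sum>r<R. round_progress M K (\<lambda>j. z j = 1) r) < T" using path[of z \<mu>] z by simp
qed

lemma finite_machine_path [simp]: "finite (machine_path K R \<mu>)"
  by (simp add: machine_path_def)

lemma slow_progress_sequential:
  assumes "M \<ge> 1" "T > K * R"
  shows "slow_progress M K R p T"
proof (rule slow_progressI[OF assms(1), of "{}"])
  fix z :: "idx \<Rightarrow> real" and \<mu>
  have "card {j \<in> machine_path K R \<mu>. z j = 1} \<le> card (machine_path K R \<mu>)" by (intro card_mono) auto
  then show "card {j \<in> machine_path K R \<mu>. z j = 1} < T" using assms(2) by (simp add: card_machine_path mult.commute)
qed auto

text \<open>Counting the successes of all machines bounds every path at once: no union bound, but a
  mean larger by the factor \<open>M\<close>.\<close>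

lemma slow_progress_all:
  assumes M: "M \<ge> 1" and p: "0 \<le> p" "p \<le> 1" and T: "2 * p * real (M * (K * R)) + 2 \<le> real T"
  shows "slow_progress M K R p T"
proof -
  let ?I = "ic_indices M K R"
  let ?N = "Pi\<^sub>M ?I (\<lambda>_. noise p)"
  let ?B = "{z \<in> space ?N. real T \<le> real (card {j \<in> ?I. z j = 1})}"
  show ?thesis
  proof (rule slow_progressI[OF M, of ?B])
    show "?B \<in> sets ?N" using card_noise_measurable[of ?I ?I p] by measurable
    have "emeasure ?N ?B \<le> ennreal (exp (2 * p * card ?I - T))"
      using p by (intro noise_tail) auto
    also have "\<dots> \<le> ennreal (exp (- 2))"
      using T by (intro ennreal_leI) (simp add: card_ic_indices)
    finally show "emeasure ?N ?B \<le> ennreal (exp (- 2))" .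
    fix z \<mu> assume z: "z \<in> space ?N" "z \<notin> ?B" and \<mu>: "\<mu> \<in> {..<R} \<rightarrow>\<^sub>E {..<M}"
    have "card {j \<in> machine_path K R \<mu>. z j = 1} \<le> card {j \<in> ?I. z j = 1}"
      using machine_path_subset[OF \<mu>] by (intro card_mono) auto
    then show "card {j \<in> machine_path K R \<mu>. z j = 1} < T" using z by simp
  qed
qed

text \<open>A union bound over the \<open>M ^ R\<close> paths costs \<open>R * ln M\<close> in the
  exponent but keeps the mean at \<open>p * (K * R)\<close>.\<close>

lemma slow_progress_parallel:
  assumes M: "M \<ge> 1" and p: "0 \<le> p" "p \<le> 1" and T: "R * ln M + 2 * p * real (K * R) + 2 \<le> real T"
  shows "slow_progress M K R p T"
proof -
  let ?N = "Pi\<^sub>M (ic_indices M K R) (\<lambda>_. noise p)"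
  let ?B = "\<lambda>\<mu>. {z \<in> space ?N. real T \<le> real (card {j \<in> machine_path K R \<mu>. z j = 1})}"
  let ?P = "{..<R} \<rightarrow>\<^sub>E {..<M}"
  have fin: "finite ?P" by (intro finite_PiE) auto
  have B: "?B \<mu> \<in> sets ?N" if "\<mu> \<in> ?P" for \<mu>
    using card_noise_measurable[OF finite_ic_indices machine_path_subset[OF that], of K p] by measurable
  show ?thesis
  proof (rule slow_progressI[OF M, of "\<Union>\<mu>\<in>?P. ?B \<mu>"])
    show "(\<Union>\<mu>\<in>?P. ?B \<mu>) \<in> sets ?N" using B fin by (intro sets.finite_UN) auto
    have "emeasure ?N (\<Union>\<mu>\<in>?P. ?B \<mu>) \<le> (\<Sum>\<mu>\<in>?P. emeasure ?N (?B \<mu>))"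
      using B fin by (intro emeasure_subadditive_finite) auto
    also have "\<dots> \<le> (\<Sum>\<mu>\<in>?P. ennreal (exp (2 * p * (R * K) - T)))"
    proof (intro sum_mono)
      show "emeasure ?N (?B \<mu>) \<le> ennreal (exp (2 * p * (R * K) - T))" if "\<mu> \<in> ?P" for \<mu>
        using noise_tail[OF finite_ic_indices machine_path_subset[OF that, of K] p, of T] unfolding card_machine_path .
    qed
    also have "\<dots> = ennreal (card ?P * exp (2 * p * (R * K) - T))"
      by (simp add: ennreal_of_nat_eq_real_of_nat ennreal_mult)
    also have "card ?P * exp (2 * p * (R * K) - T) = exp (R * ln M + (2 * p * (R * K) - T))"
    proof -
      have "real (card ?P) = exp (R * ln M)"
        using M by (simp add: card_PiE exp_of_nat_mult)
      then show ?thesis by (simp add: exp_add)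
    qed
    also have "ennreal \<dots> \<le> ennreal (exp (- 2))"
      using T by (intro ennreal_leI) (simp add: mult.commute)
    finally show "emeasure ?N (\<Union>\<mu>\<in>?P. ?B \<mu>) \<le> ennreal (exp (- 2))" .
    fix z \<mu> assume "z \<in> space ?N" "z \<notin> (\<Union>\<mu>\<in>?P. ?B \<mu>)" "\<mu> \<in> ?P"
    then show "card {j \<in> machine_path K R \<mu>. z j = 1} < T" by (auto simp: not_le)
  qed
qed

text \<open>Origin of 20500: \<open>n\<close> is the least integer the union bound allows, at most
  256 * 8 \<open>ln Q\<close> plus 1 for rounding, and \<open>1 \<le> 2 * ln Q\<close>. So
  \<open>n \<le> 2050 * ln Q\<close>, while \<open>T \<le> 10 * (K * R)\<close>.\<close>

lemma forced_gradient_dim: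
  assumes alg: "ic_algorithm M K R D S query out"
    and MKR: "M \<ge> 1" "K \<ge> 1" "R \<ge> 1" "M * (K * R) \<ge> 2"
    and D: "20500 * (real (K * R) * ln (real (M * (K * R)))) \<le> D"
    and pos: "H > 0" "\<Delta> > 0" "T > 0" and T: "T \<le> 10 * (K * R)"
    and p: "0 < p" "p \<le> 1" "p = 1 \<or> H * \<Delta> / T \<le> p * \<sigma>\<^sup>2"
    and slow: "slow_progress M K R p T"
  shows "forced_gradient M K R D S query out H \<Delta> \<sigma> (sqrt (H * \<Delta> / T) / 8000)"
proof -
  define Q where "Q = M * (K * R)"
  define n where "n = nat \<lceil>256 * ln (4 * ((Q + 1) * T))\<rceil>"
  have Q: "Q \<ge> 2" "K * R \<le> Q" using MKR by (auto simp: Q_def)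
  have q0: "1 \<le> (Q + 1) * T" using Q pos by simp
  then have q: "1 \<le> real ((Q + 1) * T)" by linarith
  have n0: "256 * ln (4 * real ((Q + 1) * T)) \<le> n" unfolding n_def by (metis of_nat_mult of_nat_numeral real_nat_ceiling_ge)
  have l0: "0 < ln (4 * real ((Q + 1) * T))" using q by (intro ln_gt_zero) linarith
  then have npos: "n > 0" using n0 by (metis of_nat_0_less_iff less_le_trans mult_pos_pos zero_less_numeral)
  have ln2: "1/2 \<le> ln (real Q)"
  proof -
    have "exp (1/2) \<le> (2::real)" using exp_bound[of "1/2"] by (simp add: power2_eq_square)
    then have "1/2 \<le> ln (2::real)" by (subst ln_ge_iff) auto
    also have "\<dots> \<le> ln (real Q)" using Q by simp
    finally show ?thesis .
  qed
  \<comment> \<open>A crude power of \<open>Q\<close> turns the logarithm into a multiple of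
    \<open>ln Q\<close>; \<open>Q \<ge> 2\<close> absorbs the constant 60 into
    \<open>Q ^ 6\<close>.\<close>
  have "4 * ((Q + 1) * T) \<le> Q ^ 8"
  proof -
    have "T \<le> 10 * Q" using T mult_le_mono2[OF Q(2), of 10] by (rule order_trans)
    then have t: "2 * T \<le> 20 * Q" by simp
    have "2 * (Q + 1) \<le> 3 * Q" using Q(1) by simp
    then have "(2 * (Q + 1)) * (2 * T) \<le> (3 * Q) * (20 * Q)" using t by (rule mult_le_mono)
    also have "\<dots> = 60 * Q\<^sup>2" by (simp add: power2_eq_square)
    also have "\<dots> \<le> 2 ^ 6 * Q\<^sup>2" by simp
    also have "\<dots> \<le> Q ^ 6 * Q\<^sup>2" using Q by (intro mult_le_mono1 power_mono) auto
    also have "\<dots> = Q ^ 8" by (simp flip: power_add)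
    finally show ?thesis by simp
  qed
  then have "real (4 * ((Q + 1) * T)) \<le> real (Q ^ 8)" by (simp only: of_nat_le_iff)
  then have "4 * real ((Q + 1) * T) \<le> real Q ^ 8" by simp
  then have "ln (4 * real ((Q + 1) * T)) \<le> ln (real Q ^ 8)"
    using q by (intro ln_mono) linarith+
  also have "\<dots> = 8 * ln Q" using Q by (simp add: ln_realpow)
  finally have l8: "ln (4 * real ((Q + 1) * T)) \<le> 8 * ln Q" .
  have "real n \<le> 256 * ln (4 * real ((Q + 1) * T)) + 1"
    unfolding n_def using l0 by simp
  then have n1: "real n \<le> 2050 * ln Q" using l8 ln2 by linarith
  have "real T * real n \<le> (10 * real (K * R)) * (2050 * ln Q)"
  proof (intro mult_mono n1)
    show "real T \<le> 10 * real (K * R)" using T by (metis of_nat_le_iff of_nat_mult of_nat_numeral)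
  qed auto
  also have "\<dots> \<le> D" using D by (simp add: Q_def mult_ac)
  finally have "T * n \<le> D" by (metis of_nat_le_iff of_nat_mult)
  moreover have "real ((M * (K * R) + 1) * T) * exp (- real n / 256) \<le> 1/4"
  proof -
    have "exp (- real n / 256) \<le> exp (- ln (4 * real ((Q + 1) * T)))" using n0 by simp
    also have "\<dots> = 1 / (4 * real ((Q + 1) * T))" using q by (simp add: exp_minus inverse_eq_divide)
    finally have "real ((Q + 1) * T) * exp (- real n / 256) \<le> real ((Q + 1) * T) * (1 / (4 * real ((Q + 1) * T)))"
      by (intro mult_left_mono) auto
    also have "\<dots> = 1/4" using q by simp
    finally show ?thesis by (simp add: Q_def)
  qed
  ultimately show ?thesis using alg pos npos p slow by (intro forced_gradient_chain) auto
qed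

subsection \<open>Choice of the parameters\<close>

lemma powr_quarter: "0 \<le> x \<Longrightarrow> x powr (1/4) = sqrt (sqrt x)" for x :: real
proof -
  assume x: "0 \<le> x"
  have "x powr (1/4) = (x powr (1/2)) powr (1/2)" by (simp add: powr_powr)
  then show ?thesis using x by (simp add: powr_half_sqrt)
qed

lemma noise_term:
  fixes h \<sigma> N :: real
  assumes "0 \<le> \<sigma>" "0 \<le> h" "0 \<le> N"
  shows "sqrt \<sigma> * (h\<^sup>2) powr (1/4) / N powr (1/4) = sqrt (\<sigma> * h / sqrt N)"
  using assms by (simp add: powr_quarter real_sqrt_mult real_sqrt_divide)

text \<open>
  The three choices of \<open>(T, p)\<close>: a noiseless chain, a chain that all machines together cannot
  traverse, and a chain that the best machine of each round cannot traverse.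
\<close>

lemma chain_parameters:
  fixes h \<sigma> :: real and M K R :: nat
  assumes pos: "h > 0" "\<sigma> > 0" and MKR: "M \<ge> 1" "K \<ge> 1" "R \<ge> 1"
  defines "N \<equiv> real (K * R)" and "Q \<equiv> real (M * (K * R))" and "L \<equiv> R * (1 + ln M)"
  obtains T :: nat and p :: real where "T > 0" "T \<le> 10 * (K * R)" "0 < p" "p \<le> 1"
    "p = 1 \<or> h\<^sup>2 / T \<le> p * \<sigma>\<^sup>2" "slow_progress M K R p T"
    "Min {h / sqrt N + sqrt (\<sigma> * h / sqrt N), h / sqrt L + sqrt (\<sigma> * h / sqrt Q), h}
       \<le> 5 * sqrt (h\<^sup>2 / T)"
proof -
  define a1 b1 a2 b2 where "a1 = h / sqrt N" and "b1 = sqrt (\<sigma> * h / sqrt N)"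
    and "a2 = h / sqrt L" and "b2 = sqrt (\<sigma> * h / sqrt Q)"
  define m where "m = Min {a1 + b1, a2 + b2, h}"
  have m: "m \<le> a1 + b1" "m \<le> a2 + b2" "m \<le> h" by (auto simp: m_def)
  have KR1: "1 \<le> K * R" using MKR by simp
  have N1: "1 \<le> N" using KR1 unfolding N_def by linarith
  have QN: "Q = M * N" by (simp add: Q_def N_def)
  have NQ: "N \<le> Q" using MKR N1 mult_right_mono[of 1 "real M" N] by (simp add: QN)
  have Q1: "1 \<le> Q" using N1 NQ by simp
  have lnM: "0 \<le> ln M" using MKR by simp
  have L1: "real R \<le> L" "1 \<le> L"
  proof -
    show "real R \<le> L" using lnM by (simp add: L_def distrib_left)
    then show "1 \<le> L" using MKR by simp
  qed
  have ab: "a1 > 0" "b1 > 0" "a2 > 0" "b2 > 0"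
    using pos N1 Q1 L1 by (auto simp: a1_def b1_def a2_def b2_def)
  have sq: "a1\<^sup>2 = h\<^sup>2 / N" "b1\<^sup>2 = \<sigma> * h / sqrt N" "a2\<^sup>2 = h\<^sup>2 / L" "b2\<^sup>2 = \<sigma> * h / sqrt Q"
    using pos N1 Q1 L1 by (auto simp: a1_def b1_def a2_def b2_def power_divide)
  have sN: "0 < sqrt N" "sqrt N * sqrt N = N" and sQ: "0 < sqrt Q" "sqrt Q * sqrt Q = Q"
    using N1 Q1 by auto
  \<comment> \<open>From \<open>2 * c\<close> and the factor 6 one gets 4 * 6 = 24, rounded up to
    5^2.\<close>
  have final: "m \<le> 5 * sqrt (h\<^sup>2 / T)" if "m \<le> 2 * c" "c\<^sup>2 \<le> 6 * (h\<^sup>2 / T)" "0 \<le> c" for c and T :: nat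
  proof -
    have "(2 * c)\<^sup>2 \<le> 24 * (h\<^sup>2 / T)" using that by (simp add: power_mult_distrib)
    also have "\<dots> \<le> 25 * (h\<^sup>2 / T)" by (intro mult_right_mono) auto
    also have "\<dots> = (5 * sqrt (h\<^sup>2 / T))\<^sup>2" by (simp add: power_mult_distrib)
    finally have "2 * c \<le> 5 * sqrt (h\<^sup>2 / T)" by (rule power2_le_imp_le) simp
    then show ?thesis using that by simp
  qed
  \<comment> \<open>If \<open>a1\<close> or \<open>b2\<close> is the larger of the two and dominates
    its partner in one of the sums, twice it bounds \<open>m\<close>. Otherwise \<open>a2\<close>
    and \<open>b1\<close> both exceed \<open>a1\<close> and \<open>b2\<close>, and \<open>m\<close>
    is at most twice the smaller of them.\<close>
  consider "b2 \<le> a1" "a2 \<le> a1 \<or> b1 \<le> a1" | "a1 < b2" "a2 \<le> b2 \<or> b1 \<le> b2"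
    | "a1 < a2" "a1 < b1" "b2 < a2" "b2 < b1" by linarith
  then show thesis
  proof cases
    case 1
    show thesis
    proof (rule that[of "K * R + 1" 1])
      show "slow_progress M K R 1 (K * R + 1)" using MKR by (intro slow_progress_sequential) auto
      have "a1\<^sup>2 \<le> 6 * (h\<^sup>2 / (K * R + 1))"
      proof -
        have "h\<^sup>2 / N \<le> h\<^sup>2 / ((K * R + 1) / 6)"
          using N1 pos by (intro divide_left_mono) (auto simp: N_def)
        then show ?thesis unfolding sq by (simp add: mult.commute)
      qed
      then show "Min {h / sqrt N + sqrt (\<sigma> * h / sqrt N), h / sqrt L + sqrt (\<sigma> * h / sqrt Q), h}
          \<le> 5 * sqrt (h\<^sup>2 / real (K * R + 1))"
        using final[of a1 "K * R + 1"] m 1 ab unfolding m_def[symmetric] a1_def[symmetric] b1_def[symmetric]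
          a2_def[symmetric] b2_def[symmetric] by auto
    qed (use KR1 in auto)
  next
    case 2
    \<comment> \<open>The solution of \<open>h\<^sup>2 / (p * Q) = p * \<sigma>\<^sup>2\<close>, so
      the variance condition holds as soon as \<open>T \<ge> p * Q\<close>.\<close>
    define p where "p = h / (\<sigma> * sqrt Q)"
    define T where "T = nat \<lceil>3 * p * Q + 2\<rceil>"
    have p0: "p > 0" using pos Q1 by (simp add: p_def)
    have "h\<^sup>2 / N < \<sigma> * h / sqrt Q"
      using power_strict_mono[OF 2(1), of 2] ab unfolding sq by simp
    then have "h * (h * sqrt Q) < h * (\<sigma> * N)"
      using sN sQ N1 by (simp add: field_simps power2_eq_square)
    then have hs: "h * sqrt Q < \<sigma> * N" using pos by simp
    have pQ: "p * Q = h * sqrt Q / \<sigma>"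
      using pos sQ by (simp add: p_def field_simps)
    \<comment> \<open>The case assumption \<open>a1 < b2\<close> says exactly this, up to
      strictness; it gives \<open>p \<le> 1\<close> and the length bound on
      \<open>T\<close>.\<close>
    have pQN: "p * Q \<le> N" using hs pos unfolding pQ by (simp add: divide_le_eq mult.commute)
    then have "p * Q \<le> 1 * Q" using NQ by simp
    then have p1: "p \<le> 1" using Q1 mult_right_le_imp_le[of p Q 1] by simp
    have T0: "3 * p * Q + 2 \<le> T" unfolding T_def by linarith
    have "0 \<le> 3 * p * Q" using p0 Q1 by simp
    then have Tle: "T \<le> 3 * p * Q + 3" unfolding T_def by linarith
    have pQ0: "0 < p * Q" using p0 Q1 by simp
    have Tpos: "0 < real T" using T0 pQ0 by linarith
    show thesis
    proof (rule that[of T p])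
      show "T > 0" using Tpos by simp
      have "real T \<le> 10 * N" using Tle pQN N1 by linarith
      then have "real T \<le> real (10 * (K * R))" by (simp add: N_def)
      then show "T \<le> 10 * (K * R)" by (simp only: of_nat_le_iff)
      have "h\<^sup>2 / T \<le> h\<^sup>2 / (p * Q)"
        using T0 pQ0 Tpos by (intro divide_left_mono) auto
      also have "\<dots> = p * \<sigma>\<^sup>2"
        using pos Q1 sQ by (simp add: p_def field_simps power2_eq_square)
      finally show "p = 1 \<or> h\<^sup>2 / T \<le> p * \<sigma>\<^sup>2" ..
      show "slow_progress M K R p T"
      proof (rule slow_progress_all)
        show "2 * p * real (M * (K * R)) + 2 \<le> T" using T0 pQ0 unfolding Q_def by simp
      qed (use MKR p0 p1 in auto)
      \<comment> \<open>If \<open>p * Q < 1\<close>, then \<open>T \<le> 6\<close> and the third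
        entry \<open>h\<close> of the minimum takes over.\<close>
      have "(min b2 h)\<^sup>2 \<le> 6 * (h\<^sup>2 / T)"
      proof (cases "p * Q \<ge> 1")
        case True
        have "b2\<^sup>2 = h\<^sup>2 / (p * Q)" unfolding sq pQ using pos sQ by (simp add: field_simps power2_eq_square)
        also have "\<dots> \<le> h\<^sup>2 / (T / 6)"
          using True Tle Tpos pQ0 by (intro divide_left_mono) auto
        finally have "b2\<^sup>2 \<le> 6 * (h\<^sup>2 / T)" by (simp add: mult.commute)
        moreover have "(min b2 h)\<^sup>2 \<le> b2\<^sup>2" using ab pos by (intro power_mono) auto
        ultimately show ?thesis by simp
      next
        case False
        then have "h\<^sup>2 / 1 \<le> h\<^sup>2 / (T / 6)"
          using Tle Tpos by (intro divide_left_mono) auto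
        moreover have "(min b2 h)\<^sup>2 \<le> h\<^sup>2" using ab pos by (intro power_mono) auto
        ultimately show ?thesis by (simp add: mult.commute)
      qed
      moreover have "m \<le> 2 * min b2 h" using m 2 ab pos by (auto simp: min_def)
      ultimately show "Min {h / sqrt N + sqrt (\<sigma> * h / sqrt N), h / sqrt L + sqrt (\<sigma> * h / sqrt Q), h}
          \<le> 5 * sqrt (h\<^sup>2 / T)"
        using final[of "min b2 h" T] ab pos unfolding m_def[symmetric] a1_def[symmetric] b1_def[symmetric]
          a2_def[symmetric] b2_def[symmetric] by auto
    qed (use p0 p1 in auto)
  next
    case 3
    \<comment> \<open>The same balance with \<open>K * R\<close> queries, since a path has one
      machine per round. Now \<open>a1 < b1\<close> gives \<open>p \<le> 1\<close> and
      \<open>a1 < a2\<close> gives \<open>L < N\<close>.\<close>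
    define p where "p = h / (\<sigma> * sqrt N)"
    define T where "T = nat \<lceil>R * ln M + 3 * p * N + 2\<rceil>"
    have p0: "p > 0" using pos N1 by (simp add: p_def)
    have "h\<^sup>2 / N < \<sigma> * h / sqrt N"
      using power_strict_mono[OF 3(2), of 2] ab unfolding sq by simp
    then have "h * (h * sqrt N) < h * (\<sigma> * N)"
      using sN N1 by (simp add: field_simps power2_eq_square)
    then have "h * sqrt N < \<sigma> * sqrt N * sqrt N" using pos sN(2) by (simp add: mult.assoc)
    then have "h < \<sigma> * sqrt N" using sN by (simp only: mult_less_cancel_right_pos)
    then have p1: "p \<le> 1" using pos sN by (simp add: p_def divide_le_eq)
    have "h\<^sup>2 / N < h\<^sup>2 / L"
      using power_strict_mono[OF 3(1), of 2] ab unfolding sq by simp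
    then have LN: "L < N"
      using pos N1 L1 by (simp add: divide_less_cancel field_simps)
    have RL: "R * ln M + R = L" by (simp add: L_def algebra_simps)
    have RlnM: "0 \<le> R * ln M" using lnM by simp
    have pN0: "0 < p * N" using p0 N1 by simp
    have T0: "R * ln M + 3 * p * N + 2 \<le> T" unfolding T_def by linarith
    have "0 \<le> 3 * p * N" using p0 N1 by simp
    then have Tle: "T \<le> R * ln M + 3 * p * N + 3" using RlnM unfolding T_def by linarith
    have R1: "1 \<le> real R" using MKR by simp
    have TL: "T \<le> 3 * L + 3 * (p * N)" using Tle RL RlnM R1 by linarith
    have Tpos: "0 < real T" using T0 pN0 RlnM by linarith
    show thesis
    proof (rule that[of T p])
      show "T > 0" using Tpos by simp
      have "p * N \<le> N" using p1 N1 p0 by (simp add: mult_left_le_one_le)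
      then have "real T \<le> 10 * N" using TL LN N1 by linarith
      then have "real T \<le> real (10 * (K * R))" by (simp add: N_def)
      then show "T \<le> 10 * (K * R)" by (simp only: of_nat_le_iff)
      have "h\<^sup>2 / T \<le> h\<^sup>2 / (p * N)"
        using T0 pN0 Tpos RlnM by (intro divide_left_mono) auto
      also have "\<dots> = p * \<sigma>\<^sup>2"
        using pos N1 sN by (simp add: p_def field_simps power2_eq_square)
      finally show "p = 1 \<or> h\<^sup>2 / T \<le> p * \<sigma>\<^sup>2" ..
      show "slow_progress M K R p T"
      proof (rule slow_progress_parallel)
        show "R * ln M + 2 * p * real (K * R) + 2 \<le> T" using T0 pN0 unfolding N_def by simp
      qed (use MKR p0 p1 in auto)
      \<comment> \<open>\<open>T\<close> is at most 6 times the larger of \<open>L\<close> and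
        \<open>p * N\<close>, to which \<open>a2\<close> and \<open>b1\<close> correspond.\<close>
      have "(min a2 b1)\<^sup>2 \<le> 6 * (h\<^sup>2 / T)"
      proof (cases "L \<le> p * N")
        case True
        have "b1\<^sup>2 = h\<^sup>2 / (p * N)" unfolding sq p_def using pos sN by (simp add: field_simps power2_eq_square)
        also have "\<dots> \<le> h\<^sup>2 / (T / 6)"
          using True TL Tpos pN0 by (intro divide_left_mono) auto
        finally have "b1\<^sup>2 \<le> 6 * (h\<^sup>2 / T)" by (simp add: mult.commute)
        moreover have "(min a2 b1)\<^sup>2 \<le> b1\<^sup>2" using ab by (intro power_mono) auto
        ultimately show ?thesis by simp
      next
        case False
        then have "a2\<^sup>2 \<le> h\<^sup>2 / (T / 6)"
          unfolding sq using TL Tpos L1 by (intro divide_left_mono) auto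
        moreover have "(min a2 b1)\<^sup>2 \<le> a2\<^sup>2" using ab by (intro power_mono) auto
        ultimately show ?thesis by (simp add: mult.commute)
      qed
      moreover have "m \<le> 2 * min a2 b1" using m 3 by (auto simp: min_def)
      ultimately show "Min {h / sqrt N + sqrt (\<sigma> * h / sqrt N), h / sqrt L + sqrt (\<sigma> * h / sqrt Q), h}
          \<le> 5 * sqrt (h\<^sup>2 / T)"
        using final[of "min a2 b1" T] ab unfolding m_def[symmetric] a1_def[symmetric] b1_def[symmetric]
          a2_def[symmetric] b2_def[symmetric] by auto
    qed (use p0 p1 in auto)
  qed
qed

subsection \<open>A single query\<close>

text \<open>The Huber function, quadratic on [-1, 1] and of slope 1 or -1 outside, written with
  squared positive parts so that \<open>max_sq_remainder\<close> applies.\<close>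

definition huber :: "real \<Rightarrow> real" where
  "huber t = (t\<^sup>2 - (max 0 (t - 1))\<^sup>2 - (max 0 (- t - 1))\<^sup>2) / 2"

definition huber' :: "real \<Rightarrow> real" where
  "huber' t = t - max 0 (t - 1) + max 0 (- t - 1)"

lemma huber_remainder: "\<bar>huber b - huber a - huber' a * (b - a)\<bar> \<le> (b - a)\<^sup>2"
proof -
  define u where "u = (max 0 (b - 1))\<^sup>2 - (max 0 (a - 1))\<^sup>2 - 2 * max 0 (a - 1) * (b - a)"
  define v where "v = (max 0 (- b - 1))\<^sup>2 - (max 0 (- a - 1))\<^sup>2 - 2 * max 0 (- a - 1) * (a - b)"
  define s where "s = (b - a)\<^sup>2"
  have u: "0 \<le> u" "u \<le> s" using max_sq_remainder[of "b - 1" "a - 1"] by (auto simp: u_def s_def)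
  have v: "0 \<le> v" "v \<le> s"
    using max_sq_remainder[of "- b - 1" "- a - 1"] by (auto simp: v_def s_def power2_commute)
  have "huber b - huber a - huber' a * (b - a) = (s - u - v) / 2"
    by (simp add: huber_def huber'_def u_def v_def s_def power2_eq_square field_simps)
  moreover have "\<bar>(s - u - v) / 2\<bar> \<le> s" using u v by simp
  ultimately show ?thesis by (simp add: s_def)
qed

lemma huber_nonneg: "0 \<le> huber t" and huber_le: "huber t \<le> t\<^sup>2 / 2"
proof -
  have "(max 0 (t - 1))\<^sup>2 + (max 0 (- t - 1))\<^sup>2 \<le> t\<^sup>2"
  proof (cases "t \<ge> 0")
    case True
    then have "(max 0 (t - 1))\<^sup>2 \<le> t\<^sup>2" "max 0 (- t - 1) = 0" by (auto intro!: power_mono)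
    then show ?thesis by simp
  next
    case False
    then have "max 0 (- t - 1) \<le> - t" by simp
    then have "(max 0 (- t - 1))\<^sup>2 \<le> (- t)\<^sup>2" by (rule power_mono) simp
    moreover have "max 0 (t - 1) = 0" using False by simp
    ultimately show ?thesis by simp
  qed
  then show "0 \<le> huber t" by (simp add: huber_def)
  have *: "(x - y - z) / 2 \<le> x / 2" if "0 \<le> y" "0 \<le> z" for x y z :: real using that by simp
  show "huber t \<le> t\<^sup>2 / 2" unfolding huber_def by (intro * zero_le_power2)
qed

lemma huber'_cases: "1 \<le> t \<Longrightarrow> huber' t = 1" "t \<le> -1 \<Longrightarrow> huber' t = -1"
  by (auto simp: huber'_def)

text \<open>
  Among the four candidate minimisers, the single query lies on the same side of two of them, at
  distance at least one; these two cannot be distinguished.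
\<close>

lemma indistinguishable_minimisers:
  obtains s t where "s \<in> {0, 3, 6, 9::real}" "t \<in> {0, 3, 6, 9}" "t - s = 3"
    "huber' (u - s) = huber' (u - t)"
proof (cases "u \<le> 5")
  case True
  then show thesis by (intro that[of 6 9]) (auto simp: huber'_cases)
next
  case False
  then show thesis by (intro that[of 0 3]) (auto simp: huber'_cases)
qed

lemma forced_gradient_single_query:
  assumes alg: "ic_algorithm 1 1 1 D S query out" and pos: "H > 0" "\<Delta> > 0" and D: "D \<ge> 1"
  shows "forced_gradient 1 1 1 D S query out H \<Delta> \<sigma> (sqrt (H * \<Delta>) / 64)"
proof -
  \<comment> \<open>The farthest minimiser has gap \<open>A * huber (- 9)\<close>, at most 81/2 < 41
    times \<open>A\<close>. Then \<open>(A * b)\<^sup>2\<close> is \<open>H * \<Delta>\<close> over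
    6 * 41 = 246 < 16^2, and averaging over four candidates turns 16 into 64.\<close>
  define A where "A = \<Delta> / 41"
  define b where "b = sqrt (H / (6 * A))"
  have A: "A > 0" using pos by (simp add: A_def)
  have b: "b > 0" using pos A by (simp add: b_def)
  have b2: "b\<^sup>2 = H / (6 * A)" using pos A by (simp add: b_def)
  define F where "F t x = A * huber (b * x 0 - t)" for t and x :: rvec
  define g where "g t x = (\<lambda>k\<in>{..<D}. if k = 0 then A * b * huber' (b * x 0 - t) else 0)" for t and x :: rvec
  define G where "G t = (\<lambda>(x, z :: real). g t x)" for t
  have g_space: "g t x \<in> space (RD D)" for t x by (simp add: g_def space_PiM)
  have sum0: "(\<Sum>k<D. f k) = f 0" if "\<And>k. k < D \<Longrightarrow> k \<noteq> 0 \<Longrightarrow> f k = 0" for f :: "nat \<Rightarrow> real"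
    using D that by (subst sum.remove[of _ 0]) auto
  have norm_g: "norm_RD D (g t x) = A * b * \<bar>huber' (b * x 0 - t)\<bar>" for t x
  proof -
    have "(\<Sum>k<D. (g t x k)\<^sup>2) = (g t x 0)\<^sup>2" by (rule sum0) (simp add: g_def)
    then show ?thesis using D A b by (simp add: L2_set_def g_def abs_mult)
  qed
  have rem: "\<bar>F t y - F t x - (\<Sum>k<D. g t x k * (y k - x k))\<bar> \<le> A * b\<^sup>2 * (dist_RD D y x)\<^sup>2" for t x y
  proof -
    have "(\<Sum>k<D. g t x k * (y k - x k)) = g t x 0 * (y 0 - x 0)" by (rule sum0) (simp add: g_def)
    then have "F t y - F t x - (\<Sum>k<D. g t x k * (y k - x k)) =
        A * (huber (b * y 0 - t) - huber (b * x 0 - t) - huber' (b * x 0 - t) * ((b * y 0 - t) - (b * x 0 - t)))"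
      using D by (simp add: F_def g_def algebra_simps)
    also have "\<bar>\<dots>\<bar> \<le> A * ((b * y 0 - t) - (b * x 0 - t))\<^sup>2"
      unfolding abs_mult using A by (intro mult_mono huber_remainder) auto
    also have "\<dots> = A * b\<^sup>2 * (y 0 - x 0)\<^sup>2" by (simp add: power_mult_distrib flip: right_diff_distrib)
    also have "\<dots> \<le> A * b\<^sup>2 * (dist_RD D y x)\<^sup>2"
      unfolding norm_RD_sq using A D by (intro mult_left_mono member_le_sum) auto
    finally show ?thesis .
  qed
  have "0 \<le> A * b\<^sup>2" using A by simp
  note smooth = quadratic_remainder_imp_smooth[OF this g_space rem]
  have H: "6 * (A * b\<^sup>2) = H" using A by (simp add: b2)
  have cls: "F t \<in> nonconvex_class D H \<Delta>" if t: "t \<in> {0, 3, 6, 9}" for t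
    unfolding nonconvex_class_def
  proof (intro CollectI conjI bexI[of _ "\<lambda>k\<in>{..<D}. if k = 0 then t / b else 0"] ballI)
    show "smooth_RD D H (F t)" using smooth(1) unfolding H .
    have F0: "F t (\<lambda>k\<in>{..<D}. if k = 0 then t / b else 0) = 0"
      using D b by (simp add: F_def huber_def)
    show "F t (\<lambda>k\<in>{..<D}. if k = 0 then t / b else 0) \<le> F t x" for x
      unfolding F0 using A huber_nonneg by (simp add: F_def)
    have "huber (- t) \<le> 41" using huber_le[of "- t"] t by auto
    then have "A * huber (- t) \<le> A * 41" using A by (intro mult_left_mono) auto
    then show "F t (\<lambda>i\<in>{..<D}. 0) - F t (\<lambda>k\<in>{..<D}. if k = 0 then t / b else 0) \<le> \<Delta>"
      unfolding F0 using D by (simp add: F_def A_def)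
  qed (simp add: space_PiM)
  have g_meas: "g t \<in> RD D \<rightarrow>\<^sub>M RD D" for t
    unfolding g_def
  proof (intro measurable_restrict)
    fix k
    have [measurable]: "(\<lambda>x. x 0) \<in> borel_measurable (RD D)"
      using D by (intro measurable_component_singleton) auto
    show "(\<lambda>x. if k = 0 then A * b * huber' (b * x 0 - t) else 0) \<in> borel_measurable (RD D)"
      unfolding huber'_def by measurable
  qed
  have G_meas: "G t \<in> RD D \<Otimes>\<^sub>M noise 1 \<rightarrow>\<^sub>M RD D" for t
    using measurable_compose[OF measurable_fst g_meas] by (simp add: G_def split_beta')
  have is_oracle: "stoch_grad_oracle D (F t) \<sigma> (noise 1) (G t)" for t
  proof -
    interpret prob_space "noise 1" by (rule prob_space_noise)
    show ?thesis
      unfolding stoch_grad_oracle_def using prob_space_axioms G_meas smooth(2)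
      by (auto simp: G_def prob_space L2_set_def)
  qed
  let ?N = "Pi\<^sub>M (ic_indices 1 1 1) (\<lambda>_. noise 1)"
  let ?P = "S \<Otimes>\<^sub>M ?N"
  interpret S: prob_space S using alg by (simp add: ic_algorithm_def)
  interpret N: prob_space ?N by (intro prob_space_PiM prob_space_noise)
  interpret P: pair_prob_space S ?N ..
  define x where "x t a = ic_output 1 1 1 query out (G t) (fst a) (snd a)" for t and a :: "real \<times> (idx \<Rightarrow> real)"
  have x: "x t \<in> ?P \<rightarrow>\<^sub>M RD D" for t
    using ic_output_measurable[OF alg G_meas] unfolding x_def split_beta' .
  define f where "f t a = ennreal (norm_RD D (g t (x t a)))" for t a
  have f: "f t \<in> borel_measurable ?P" for t
    unfolding f_def using measurable_compose[OF measurable_compose[OF x g_meas] norm_RD_measurable]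
    by simp
  have E: "expected_grad_norm 1 1 1 D S query out (F t) (noise 1) (G t) = (\<integral>\<^sup>+a. f t a \<partial>?P)" for t
    unfolding expected_grad_norm_def
  proof (intro nn_integral_cong)
    fix a assume "a \<in> space ?P"
    then have "x t a \<in> space (RD D)" using x by (rule measurable_space[rotated])
    then show "(case a of (w, z) \<Rightarrow> ennreal (norm_RD D (grad D (F t) (ic_output 1 1 1 query out (G t) w z)))) = f t a"
      unfolding f_def split_beta' x_def by (subst smooth(2)) auto
  qed
  \<comment> \<open>The only query has an empty history and depends on the seed alone; equal answers
    then give equal outputs.\<close>
  have same: "x s a = x t a"
    if eq: "huber' (b * query (0, 0, 0) (fst a, \<lambda>_\<in>{}. undefined) 0 - s) = huber' (b * query (0, 0, 0) (fst a, \<lambda>_\<in>{}. undefined) 0 - t)"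
    for s t a
  proof -
    let ?q = "query (0, 0, 0) (fst a, \<lambda>_\<in>{}. undefined)"
    have vis: "ic_visible 1 1 (0, 0, 0) = {}" by (auto simp: ic_visible_def)
    have tr: "ic_transcript 1 1 query (G r) (fst a) (snd a) (0, 0, 0) = (?q, g r ?q)" for r
      by (subst ic_transcript.simps) (simp add: vis G_def Let_def restrict_def del: One_nat_def)
    have "g s ?q = g t ?q" unfolding g_def eq ..
    moreover have "ic_indices 1 1 1 = {(0, 0, 0)}" by (auto simp: ic_indices_def)
    ultimately show ?thesis
      unfolding x_def ic_output_def by (auto simp: tr simp del: One_nat_def intro!: arg_cong[of _ _ out] restrict_ext)
  qed
  have pt: "A * b \<le> (\<Sum>t\<in>{0, 3, 6, 9}. norm_RD D (g t (x t a)))" for a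
  proof -
    obtain s t where st: "s \<in> {0, 3, 6, 9}" "t \<in> {0, 3, 6, 9}" "t - s = 3"
      "huber' (b * query (0, 0, 0) (fst a, \<lambda>_\<in>{}. undefined) 0 - s) = huber' (b * query (0, 0, 0) (fst a, \<lambda>_\<in>{}. undefined) 0 - t)"
      by (rule indistinguishable_minimisers)
    define v where "v = b * x s a 0"
    \<comment> \<open>The gap 3 exceeds 2, so the output lies on the saturated part of at least one
      of the two functions.\<close>
    have "1 \<le> v - s \<or> v - t \<le> -1" using st(3) by linarith
    then have "1 \<le> \<bar>huber' (v - s)\<bar> + \<bar>huber' (v - t)\<bar>" by (auto simp: huber'_cases)
    then have "A * b * 1 \<le> A * b * (\<bar>huber' (v - s)\<bar> + \<bar>huber' (v - t)\<bar>)"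
      using A b by (intro mult_left_mono) auto
    also have "\<dots> = norm_RD D (g s (x s a)) + norm_RD D (g t (x t a))"
      unfolding norm_g same[OF st(4), symmetric] v_def by (simp add: distrib_left)
    also have "\<dots> = (\<Sum>t\<in>{s, t}. norm_RD D (g t (x t a)))" using st(3) by auto
    also have "\<dots> \<le> (\<Sum>t\<in>{0, 3, 6, 9}. norm_RD D (g t (x t a)))"
      using st(1,2) by (intro sum_mono2) (auto simp: L2_set_nonneg)
    finally show ?thesis by simp
  qed
  have "ennreal (A * b) = (\<integral>\<^sup>+a. ennreal (A * b) \<partial>?P)"
    unfolding nn_integral_const P.emeasure_space_1 by simp
  also have "\<dots> \<le> (\<integral>\<^sup>+a. (\<Sum>t\<in>{0, 3, 6, 9}. f t a) \<partial>?P)"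
    unfolding f_def by (intro nn_integral_mono) (subst sum_ennreal, auto simp: L2_set_nonneg intro!: ennreal_leI pt simp del: sum.insert)
  finally have "ennreal (card {0, 3, 6, 9::real} * (A * b / 4)) \<le> (\<integral>\<^sup>+a. (\<Sum>t\<in>{0, 3, 6, 9}. f t a) \<partial>?P)"
    by simp
  then obtain t where t: "t \<in> {0, 3, 6, 9}" "ennreal (A * b / 4) \<le> (\<integral>\<^sup>+a. f t a \<partial>?P)"
    using exists_nn_integral_ge_average[of "{0, 3, 6, 9::real}" f ?P "A * b / 4"] f by auto
  have "sqrt (H * \<Delta>) / 16 \<le> A * b"
  proof (rule power2_le_imp_le)
    have "(sqrt (H * \<Delta>) / 16)\<^sup>2 = H * \<Delta> / 256" using pos by (simp add: power_divide)
    also have "\<dots> \<le> H * \<Delta> / 246" using pos by (intro divide_left_mono) auto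
    also have "\<dots> = (A * b)\<^sup>2" using A unfolding power_mult_distrib b2 by (simp add: A_def power2_eq_square)
    finally show "(sqrt (H * \<Delta>) / 16)\<^sup>2 \<le> (A * b)\<^sup>2" .
  qed (use A b in simp)
  then have "ennreal (sqrt (H * \<Delta>) / 64) \<le> expected_grad_norm 1 1 1 D S query out (F t) (noise 1) (G t)"
    unfolding E by (intro order_trans[OF ennreal_leI t(2)]) simp
  then show ?thesis unfolding forced_gradient_def using cls[OF t(1)] is_oracle by blast
qed

text \<open>The hard function is chosen after the algorithm, as the averaging argument yields it.
  The constant \<open>c1\<close> is the 20500 of the dimension count and \<open>c2\<close> is 1 / (5
  * 8000). The requirement \<open>D \<ge> 1\<close> matters for \<open>M = K = R = 1\<close>, where
  the logarithm vanishes.\<close>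

theorem theorem15:
  "\<exists>c1>0::real. \<exists>c2>0::real.
     \<forall>M K R :: nat. \<forall>H \<Delta> \<sigma> :: real. \<forall>D :: nat.
       M \<ge> 1 \<and> K \<ge> 1 \<and> R \<ge> 1 \<and> H > 0 \<and> \<Delta> > 0 \<and> \<sigma> > 0 \<and>
       D \<ge> 1 \<and> real D \<ge> c1 * (real K * real R * ln (real M * real K * real R)) \<longrightarrow>
       (\<forall>S query out. ic_algorithm M K R D S query out \<longrightarrow>
          (\<exists>F\<in>nonconvex_class D H \<Delta>. \<exists>Z G. stoch_grad_oracle D F \<sigma> Z G \<and>
             expected_grad_norm M K R D S query out F Z G \<ge>
               ennreal (c2 * Min
                 {sqrt (H * \<Delta>) / sqrt (real K * real R) +
                    sqrt \<sigma> * (H * \<Delta>) powr (1/4) / (real K * real R) powr (1/4),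
                  sqrt (H * \<Delta>) / sqrt (real R * (1 + ln (real M))) +
                    sqrt \<sigma> * (H * \<Delta>) powr (1/4) / (real M * real K * real R) powr (1/4),
                  sqrt (H * \<Delta>)})))"
proof (rule exI[of _ 20500], rule conjI, simp, rule exI[of _ "1/40000"], rule conjI, simp, intro allI impI, elim conjE)
  fix M K R D :: nat and H \<Delta> \<sigma> :: real
    and S :: "real measure" and query :: "idx \<Rightarrow> real \<times> history \<Rightarrow> rvec" and out :: "real \<times> history \<Rightarrow> rvec"
  assume MKR: "M \<ge> 1" "K \<ge> 1" "R \<ge> 1" and pos: "H > 0" "\<Delta> > 0" "\<sigma> > 0"
    and D: "D \<ge> 1" "real D \<ge> 20500 * (real K * real R * ln (real M * real K * real R))"
    and alg: "ic_algorithm M K R D S query out"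
  define h where "h = sqrt (H * \<Delta>)"
  have h: "h > 0" "h\<^sup>2 = H * \<Delta>" using pos by (auto simp: h_def)
  define N Q where "N = real (K * R)" and "Q = real (M * (K * R))"
  define m where "m = Min {h / sqrt N + sqrt (\<sigma> * h / sqrt N),
    h / sqrt (R * (1 + ln M)) + sqrt (\<sigma> * h / sqrt Q), h}"
  have "forced_gradient M K R D S query out H \<Delta> \<sigma> (1/40000 * m)"
  proof (cases "M * (K * R) \<ge> 2")
    case True
    obtain T p where Tp: "T > 0" "T \<le> 10 * (K * R)" "0 < p" "p \<le> 1"
      "p = 1 \<or> h\<^sup>2 / T \<le> p * \<sigma>\<^sup>2" "slow_progress M K R p T" "m \<le> 5 * sqrt (h\<^sup>2 / T)"
      using chain_parameters[OF h(1) pos(3) MKR] unfolding m_def N_def Q_def by metis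
    have "20500 * (real (K * R) * ln (real (M * (K * R)))) \<le> D" using D(2) by (simp add: mult.assoc)
    from forced_gradient_dim[OF alg MKR True this pos(1,2) Tp(1-4) _ Tp(6), of \<sigma>] Tp(5)
    have "forced_gradient M K R D S query out H \<Delta> \<sigma> (sqrt (h\<^sup>2 / T) / 8000)"
      unfolding h(2) by blast
    then show ?thesis by (rule forced_gradient_mono) (use Tp(7) in simp)
  next
    case False
    moreover have "M * (K * R) \<ge> 1" using MKR by simp
    ultimately have "M * (K * R) = 1" by linarith
    then have one: "M = 1" "K = 1" "R = 1" by auto
    have "m \<le> h" by (simp add: m_def)
    then have "1/40000 * m \<le> sqrt (H * \<Delta>) / 64" using h(1) unfolding h_def[symmetric] by linarith
    then show ?thesis
      using forced_gradient_single_query[OF alg[unfolded one] pos(1,2) D(1), of \<sigma>] forced_gradient_mono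
      unfolding one by blast
  qed
  moreover have "Min {sqrt (H * \<Delta>) / sqrt (real K * real R) +
        sqrt \<sigma> * (H * \<Delta>) powr (1/4) / (real K * real R) powr (1/4),
      sqrt (H * \<Delta>) / sqrt (real R * (1 + ln (real M))) +
        sqrt \<sigma> * (H * \<Delta>) powr (1/4) / (real M * real K * real R) powr (1/4),
      sqrt (H * \<Delta>)} = m"
    using noise_term[of \<sigma> h N] noise_term[of \<sigma> h Q] pos h
    by (simp add: m_def h_def[symmetric] N_def Q_def mult.assoc)
  ultimately show "\<exists>F\<in>nonconvex_class D H \<Delta>. \<exists>Z G. stoch_grad_oracle D F \<sigma> Z G \<and>
       expected_grad_norm M K R D S query out F Z G \<ge>
         ennreal (1/40000 * Min
           {sqrt (H * \<Delta>) / sqrt (real K * real R) +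
              sqrt \<sigma> * (H * \<Delta>) powr (1/4) / (real K * real R) powr (1/4),
            sqrt (H * \<Delta>) / sqrt (real R * (1 + ln (real M))) +
              sqrt \<sigma> * (H * \<Delta>) powr (1/4) / (real M * real K * real R) powr (1/4),
            sqrt (H * \<Delta>)})"
    unfolding forced_gradient_def by simp
qed

end
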